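(* Let $A$ be a simple unital $\mathrm{C}^*$-algebra. Let $H$ be a subgroup of $\mathrm{G}_A$ normalized by $(\mathrm{G}_A,\mathrm{G}_A)$. Then either $H$ is contained in the center of $A$ or $(\mathrm{G}_A,\mathrm{G}_A)\subseteq H$. Moreover, the group $(\mathrm{G}_A,\mathrm{G}_A)$ is simple modulo its center.
   Context: $\mathrm{G}_A$ denotes the connected component of the identity (in the norm topology) of the group of invertible elements of the unital $\mathrm{C}^*$-algebra $A$. $(\mathrm{G}_A,\mathrm{G}_A)$ denotes the (algebraic, not closed) commutator subgroup of $\mathrm{G}_A$, generated by the elements $xyx^{-1}y^{-1}$ with $x,y\in\mathrm{G}_A$. $H$ is not assumed closed; "$H$ is normalized by $K$" means $kHk^{-1}=H$ for all $k\in K$. A group is simple modulo its center if its quotient by its center has no normal subgroups other than the trivial subgroup and the whole quotient (the quotient is allowed to be trivial, as happens for $A=\mathbb{C}$). Simple for a $\mathrm{C}^*$-algebra means having no closed two-sided ideals other than $\{0\}$ and itself. *)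

theory Defs
  imports "HOL-Analysis.Analysis" "HOL-Algebra.Generated_Groups"
begin

text \<open>
  A unital $C^*$-algebra is modelled as a type. The base class \<^class>\<open>real_normed_algebra_1\<close>
  contributes the unit, with norm 1, and the submultiplicative norm; in particular
  \<open>0 \<noteq> 1\<close>, so the zero algebra is not an instance.
\<close>

class unital_cstar_algebra = real_normed_algebra_1 + banach +
  fixes scaleC :: "complex \<Rightarrow> 'a \<Rightarrow> 'a"  (infixr "*\<^sub>C" 75)
    and star :: "'a \<Rightarrow> 'a"
  assumes scaleC_add_right: "c *\<^sub>C (x + y) = c *\<^sub>C x + c *\<^sub>C y"
    and scaleC_add_left: "(c + d) *\<^sub>C x = c *\<^sub>C x + d *\<^sub>C x"
    and scaleC_scaleC: "c *\<^sub>C d *\<^sub>C x = (c * d) *\<^sub>C x"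
    and scaleR_eq_scaleC: "scaleR r x = complex_of_real r *\<^sub>C x"
    and mult_scaleC_left: "(c *\<^sub>C x) * y = c *\<^sub>C (x * y)"
    and mult_scaleC_right: "x * (c *\<^sub>C y) = c *\<^sub>C (x * y)"
    and norm_scaleC: "norm (c *\<^sub>C x) = cmod c * norm x"
    and star_add: "star (x + y) = star x + star y"
    and star_scaleC: "star (c *\<^sub>C x) = cnj c *\<^sub>C star x"
    and star_mult: "star (x * y) = star y * star x"
    and star_star: "star (star x) = x"
    and cstar_identity: "norm (star x * x) = (norm x)\<^sup>2"

definition closed_two_sided_ideal :: "'a::unital_cstar_algebra set \<Rightarrow> bool" where
  "closed_two_sided_ideal I \<longleftrightarrow>
     closed I \<and> 0 \<in> I \<and> (\<forall>x\<in>I. \<forall>y\<in>I. x + y \<in> I) \<and> (\<forall>c. \<forall>x\<in>I. c *\<^sub>C x \<in> I) \<and>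
     (\<forall>a. \<forall>x\<in>I. a * x \<in> I \<and> x * a \<in> I)"

definition simple_cstar_algebra :: "'a::unital_cstar_algebra itself \<Rightarrow> bool" where
  "simple_cstar_algebra _ \<longleftrightarrow>
     (\<forall>I :: 'a set. closed_two_sided_ideal I \<longrightarrow> I = {0} \<or> I = UNIV)"

definition algebra_center :: "'a::unital_cstar_algebra set" where
  "algebra_center = {z. \<forall>a. z * a = a * z}"

definition mult_monoid :: "'a::unital_cstar_algebra monoid" where
  "mult_monoid = \<lparr>carrier = UNIV, mult = (*), one = 1\<rparr>"

definition GA :: "'a::unital_cstar_algebra monoid" where
  "GA = (units_of mult_monoid)
     \<lparr>carrier := connected_component_set (carrier (units_of mult_monoid)) 1\<rparr>"

definition comm_GA :: "'a::unital_cstar_algebra monoid" where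
  "comm_GA = GA\<lparr>carrier := derived GA (carrier GA)\<rparr>"

definition normalized_by :: "('a, 'b) monoid_scheme \<Rightarrow> 'a set \<Rightarrow> 'a set \<Rightarrow> bool" where
  "normalized_by G H K \<longleftrightarrow>
     (\<forall>k\<in>K. (\<lambda>h. k \<otimes>\<^bsub>G\<^esub> h \<otimes>\<^bsub>G\<^esub> inv\<^bsub>G\<^esub> k) ` H = H)"

definition group_center :: "('a, 'b) monoid_scheme \<Rightarrow> 'a set" where
  "group_center G = {z \<in> carrier G. \<forall>x\<in>carrier G. z \<otimes>\<^bsub>G\<^esub> x = x \<otimes>\<^bsub>G\<^esub> z}"

text \<open>
  The locale \<open>simple_group\<close> of HOL-Algebra is not used here: it asks for
  \<open>order G > 1\<close>, which excludes infinite groups (whose \<^const>\<open>order\<close> is 0) as well as the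
  trivial group.
\<close>

definition simple_modulo_center :: "('a, 'b) monoid_scheme \<Rightarrow> bool" where
  "simple_modulo_center G \<longleftrightarrow> group G \<and>
     (\<forall>N. N \<lhd> (G Mod group_center G) \<longrightarrow>
        N = {\<one>\<^bsub>G Mod group_center G\<^esub>} \<or> N = carrier (G Mod group_center G))"

end

theory Submission
  imports Defs
begin

text \<open>
  Write \<open>G\<close> for the connected group of invertibles and \<open>K\<close> for its commutator subgroup. If \<open>A\<close> is
  commutative there is nothing to prove. Otherwise \<open>A\<close> has zero divisors, that is, null pairs of
  nonzero elements \<open>c\<close>, \<open>d\<close> with \<open>d c = 0\<close>. The elements \<open>1 + c a d\<close>, here called root
  elements, take the place of elementary matrices in a ring that may have no nontrivial
  idempotents. The theorem splits into two facts about them.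

  First, \<open>K\<close> is generated by root elements (\<open>root_in_K\<close>, \<open>commutators_in_root_group\<close>). The key
  point is that \<open>1 + c b\<close> and \<open>1 + b' d\<close> commute up to a root element. As \<open>A\<close> is simple, products
  of elements \<open>1 + b' d e\<close>, with \<open>e\<close> in the group generated by root elements, fill a
  neighbourhood of \<open>1\<close>. So \<open>1 + c b\<close> is central in \<open>G\<close> modulo root elements, and the conjugates
  of such elements again generate \<open>G\<close>, whose quotient is therefore abelian.

  Second, a noncentral subgroup \<open>H\<close> normalized by \<open>K\<close> contains all root elements
  (\<open>noncentral_contains_roots\<close>). If \<open>h \<in> H\<close> satisfies \<open>d h c \<noteq> 0\<close> and \<open>d h\<^sup>-\<^sup>1 c \<noteq> 0\<close>, then the
  group of root elements \<open>1 + c a d\<close> and its conjugate by \<open>h\<close> agree modulo \<open>H\<close> but together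
  generate Whitehead's diagonal elements; since the former commute and the latter act
  nontrivially, \<open>H\<close> contains many root elements (\<open>whitehead_commutator\<close>). A theorem about Jordan
  ideals in the style of Herstein (\<open>jordan_span_full\<close>) shows that these are all the root elements of
  the pair. It remains to find such an \<open>h\<close> for some null pair and to move from there to every null
  pair.

  Zero divisors come from the \<open>C\<^sup>*\<close>-identity, by way of square roots of self-adjoint elements.
  The ring theoretic arguments rest on two consequences of simplicity: every nonzero element generates \<open>A\<close> as a two-sided ideal, and \<open>x A y = 0\<close> only
  if \<open>x = 0\<close> or \<open>y = 0\<close>.
\<close>

section \<open>The Neumann series\<close>

definition neumann :: "'a::{real_normed_algebra_1,banach} \<Rightarrow> 'a" where
  "neumann a = (\<Sum>n. a ^ n)"

lemma neumann_summable:
  fixes a :: "'a::{real_normed_algebra_1,banach}"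
  assumes "norm a < 1"
  shows "summable (\<lambda>n. a ^ n)"
proof (rule summable_comparison_test')
  show "summable (\<lambda>n. norm a ^ n)"
    using assms by (intro summable_geometric) simp
  show "norm (a ^ n) \<le> norm a ^ n" if "n \<ge> 0" for n
    by (rule norm_power_ineq)
qed

lemma
  fixes a :: "'a::{real_normed_algebra_1,banach}"
  assumes "norm a < 1"
  shows neumann_right: "(1 - a) * neumann a = 1"
    and neumann_left: "neumann a * (1 - a) = 1"
proof -
  have s: "summable (\<lambda>n. a ^ n)" by (rule neumann_summable[OF assms])
  have *: "(\<Sum>n. a ^ Suc n) = neumann a - 1"
    using suminf_split_head[OF s] by (simp add: neumann_def)
  have "(\<Sum>n. a ^ Suc n) = a * neumann a"
    using suminf_mult[OF s, of a] by (simp add: neumann_def)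
  with * show "(1 - a) * neumann a = 1" by (simp add: algebra_simps)
  have "(\<Sum>n. a ^ Suc n) = neumann a * a"
    using suminf_mult2[OF s, of a] by (simp add: neumann_def power_commutes)
  with * show "neumann a * (1 - a) = 1" by (simp add: algebra_simps)
qed

lemma neumann_norm:
  fixes a :: "'a::{real_normed_algebra_1,banach}"
  assumes "norm a \<le> 1/2"
  shows "norm (neumann a) \<le> 2"
proof -
  have "neumann a = 1 + a * neumann a"
    using neumann_right[of a] assms by (simp add: algebra_simps)
  then have "norm (neumann a) \<le> 1 + norm (a * neumann a)"
    using norm_triangle_ineq[of 1 "a * neumann a"] by simp
  also have "norm (a * neumann a) \<le> 1/2 * norm (neumann a)"
    using norm_mult_ineq[of a "neumann a"] mult_right_mono[OF assms norm_ge_zero]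
    by (rule order_trans)
  finally show ?thesis by simp
qed

section \<open>The connected group of invertibles\<close>

abbreviation G :: "'a::unital_cstar_algebra set" where "G \<equiv> carrier GA"
abbreviation K :: "'a::unital_cstar_algebra set" where "K \<equiv> carrier comm_GA"
abbreviation iv :: "'a::unital_cstar_algebra \<Rightarrow> 'a" where "iv \<equiv> m_inv GA"

definition invertibles :: "'a::unital_cstar_algebra set" where
  "invertibles = {x. \<exists>y. y * x = 1 \<and> x * y = 1}"

lemma carrier_units: "carrier (units_of mult_monoid) = (invertibles :: 'a::unital_cstar_algebra set)"
  by (auto simp: units_of_def Units_def mult_monoid_def invertibles_def)

lemma G_eq: "G = connected_component_set invertibles 1"
  by (simp add: GA_def carrier_units)

lemma GA_mult [simp]: "x \<otimes>\<^bsub>GA\<^esub> y = x * y"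
  by (simp add: GA_def units_of_def mult_monoid_def)

lemma GA_one [simp]: "\<one>\<^bsub>GA\<^esub> = 1"
  by (simp add: GA_def units_of_def mult_monoid_def)

lemma invertibles_one: "1 \<in> invertibles"
  unfolding invertibles_def by (auto intro: exI[of _ 1])

lemma invertibles_mult: "x \<in> invertibles \<Longrightarrow> y \<in> invertibles \<Longrightarrow> x * y \<in> invertibles"
  unfolding invertibles_def
proof clarify
  fix x' y' assume "x' * x = 1" "x * x' = 1" "y' * y = 1" "y * y' = 1"
  then have "(y' * x') * (x * y) = 1 \<and> (x * y) * (y' * x') = 1"
    by (metis mult.assoc mult_1_right)
  then show "\<exists>z. z * (x * y) = 1 \<and> x * y * z = 1" by blast
qed

lemma G_subset: "G \<subseteq> invertibles"
  unfolding G_eq by (rule connected_component_subset)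

lemma G_one: "1 \<in> G"
  unfolding G_eq by (simp add: invertibles_one)

lemma G_connected_incl:
  assumes "connected S" "S \<subseteq> invertibles" "1 \<in> S"
  shows "S \<subseteq> G"
  unfolding G_eq by (rule connected_component_maximal[OF assms(3,1,2)])

lemma G_mult_image:
  assumes "x \<in> invertibles"
  shows "connected ((\<lambda>y. x * y) ` G)" "(\<lambda>y. x * y) ` G \<subseteq> invertibles"
  using assms G_subset invertibles_mult
  by (auto intro!: connected_continuous_image continuous_intros simp: G_eq subset_iff)

lemma G_mult: assumes "x \<in> G" "y \<in> G" shows "x * y \<in> G"
proof -
  have x: "x \<in> invertibles" using assms G_subset by auto
  have "x \<in> (\<lambda>y. x * y) ` G" using G_one by force
  then have "(\<lambda>y. x * y) ` G \<subseteq> connected_component_set invertibles x"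
    by (intro connected_component_maximal G_mult_image x)
  also have "\<dots> = G" using assms(1) connected_component_eq unfolding G_eq by fastforce
  finally show ?thesis using assms(2) by auto
qed

text \<open>
  Left multiplication by the inverse of \<open>x\<close> maps \<open>G\<close> onto a connected set of invertibles that
  contains both \<open>1\<close> (the image of \<open>x\<close>) and the inverse (the image of \<open>1\<close>).
\<close>

lemma G_inverse: assumes "x \<in> G" "y * x = 1" "x * y = 1" shows "y \<in> G"
proof -
  have y: "y \<in> invertibles" using assms unfolding invertibles_def by auto
  have "(\<lambda>z. y * z) ` G \<subseteq> G"
    using assms by (intro G_connected_incl G_mult_image y) force
  then show ?thesis using G_one by force
qed

lemma group_GA: "group (GA :: 'a::unital_cstar_algebra monoid)"
proof (rule groupI; simp add: G_mult G_one mult.assoc)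
  fix x :: 'a assume x: "x \<in> G"
  then obtain y where "y * x = 1" "x * y = 1" using G_subset unfolding invertibles_def by auto
  then show "\<exists>y\<in>G. y * x = 1" using G_inverse[OF x] by blast
qed

interpretation GA: group GA by (rule group_GA)

lemma iv_closed: "x \<in> G \<Longrightarrow> iv x \<in> G" by simp
lemma iv_left: "x \<in> G \<Longrightarrow> iv x * x = 1" using GA.l_inv by force
lemma iv_right: "x \<in> G \<Longrightarrow> x * iv x = 1" using GA.r_inv by force
lemma iv_eqI: "x \<in> G \<Longrightarrow> y * x = 1 \<Longrightarrow> iv x = y"
  by (metis G_one iv_right mult.assoc mult_1_left mult_1_right)

lemma near_one_in_G:
  assumes "norm a < 1" shows "1 + a \<in> G"
proof -
  have "ball 1 1 \<subseteq> (G :: 'a set)"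
  proof (rule G_connected_incl)
    show "ball 1 1 \<subseteq> (invertibles :: 'a set)"
    proof
      fix x :: 'a assume "x \<in> ball 1 1"
      then have "norm (1 - x) < 1" by (simp add: dist_norm)
      from neumann_left[OF this] neumann_right[OF this] show "x \<in> invertibles"
        unfolding invertibles_def by auto
    qed
  qed auto
  then show ?thesis using assms by (auto simp: dist_norm)
qed

text \<open>
  The line of all \<open>1 + t x\<close> consists of invertibles, since \<open>1 - t x\<close> inverts \<open>1 + t x\<close>.
\<close>

lemma square_zero_in_G:
  assumes "x * x = (0::'a::unital_cstar_algebra)" shows "1 + x \<in> G"
proof -
  let ?S = "(\<lambda>t::real. 1 + t *\<^sub>R x) ` UNIV"
  have "?S \<subseteq> G"
  proof (rule G_connected_incl)
    show "connected ?S"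
      by (intro connected_continuous_image continuous_intros) auto
    show "?S \<subseteq> invertibles"
    proof clarify
      fix t :: real
      show "1 + t *\<^sub>R x \<in> invertibles" unfolding invertibles_def
        by (rule CollectI, rule exI[of _ "1 - t *\<^sub>R x"]) (simp add: algebra_simps assms)
    qed
    show "1 \<in> ?S" by (rule image_eqI[of _ _ 0]) auto
  qed
  then have "1 + 1 *\<^sub>R x \<in> G" by blast
  then show ?thesis by simp
qed

text \<open>
  A subgroup that contains a ball around \<open>1\<close> is open, and so are its cosets; a connected
  group has no proper open subgroup.
\<close>

lemma open_subgroup_eq_G:
  fixes S :: "'a::unital_cstar_algebra set"
  assumes S: "subgroup S GA" and \<delta>: "\<delta> > 0" and near: "\<And>a. norm a < \<delta> \<Longrightarrow> 1 + a \<in> S"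
  shows "S = G"
proof -
  interpret S: subgroup S GA by (rule S)
  have SG: "S \<subseteq> G" by (rule S.subset)
  have nbhd: "\<exists>\<epsilon>>0. \<forall>y. dist y x < \<epsilon> \<longrightarrow> (\<exists>s\<in>S. y = x * s)" if x: "x \<in> G" for x
  proof (intro exI[of _ "\<delta> / (1 + norm (iv x))"] conjI allI impI)
    have pos: "1 + norm (iv x) > 0" using norm_ge_zero[of "iv x"] by linarith
    then show "\<delta> / (1 + norm (iv x)) > 0" using \<delta> by simp
    fix y assume "dist y x < \<delta> / (1 + norm (iv x))"
    then have "norm (y - x) * (1 + norm (iv x)) < \<delta>"
      using pos by (simp add: dist_norm field_simps)
    moreover have "norm (iv x * (y - x)) \<le> norm (y - x) * (1 + norm (iv x))"
      using norm_mult_ineq[of "iv x" "y - x"] by (simp add: algebra_simps add_increasing)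
    ultimately have "1 + iv x * (y - x) \<in> S" by (intro near) simp
    moreover have "y = x * (1 + iv x * (y - x))"
    proof -
      have "x * (1 + iv x * (y - x)) = x + (x * iv x) * (y - x)"
        by (simp add: distrib_left mult.assoc)
      then show ?thesis by (simp add: iv_right[OF x])
    qed
    ultimately show "\<exists>s\<in>S. y = x * s" by blast
  qed
  have "open S"
    unfolding open_dist
  proof
    fix x assume x: "x \<in> S"
    then obtain e where "e > 0" "\<forall>y. dist y x < e \<longrightarrow> (\<exists>s\<in>S. y = x * s)"
      using nbhd SG by blast
    then show "\<exists>e>0. \<forall>y. dist y x < e \<longrightarrow> y \<in> S"
      using S.m_closed[OF x] by (metis GA_mult)
  qed
  moreover have "open (G - S)"
    unfolding open_dist
  proof
    fix x assume x: "x \<in> G - S"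
    then obtain e where e: "e > 0" "\<And>y. dist y x < e \<Longrightarrow> (\<exists>s\<in>S. y = x * s)"
      using nbhd by blast
    have "y \<in> G - S" if "dist y x < e" for y
    proof -
      obtain s where s: "s \<in> S" "y = x * s" using e(2)[OF \<open>dist y x < e\<close>] by blast
      have "y \<in> G" using s x SG G_mult by auto
      moreover have "y \<notin> S"
      proof
        assume "y \<in> S"
        then have "y * iv s \<in> S" using S.m_closed[of y "iv s"] S.m_inv_closed[OF s(1)] by simp
        moreover have "y * iv s = x" using s SG by (simp add: mult.assoc iv_right subset_iff)
        ultimately show False using x by simp
      qed
      ultimately show ?thesis by simp
    qed
    then show "\<exists>e>0. \<forall>y. dist y x < e \<longrightarrow> y \<in> G - S" using e(1) by blast
  qed
  moreover have "connected G" unfolding G_eq by simp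
  moreover have "S \<inter> G \<noteq> {}" using S.one_closed G_one by auto
  ultimately have "(G - S) \<inter> G = {}"
    using connectedD[of G S "G - S"] by blast
  then show ?thesis using SG by auto
qed

section \<open>Square roots and zero divisors\<close>

lemma star_zero [simp]: "star (0::'a::unital_cstar_algebra) = 0"
  using star_add[of "0::'a" 0] by simp

lemma star_minus: "star (- x) = - star (x::'a::unital_cstar_algebra)"
  using star_add[of x "- x"] by (simp add: add_eq_0_iff)

lemma star_diff: "star (x - y) = star x - star (y::'a::unital_cstar_algebra)"
  using star_add[of x "- y"] by (simp add: star_minus)

lemma star_one [simp]: "star (1::'a::unital_cstar_algebra) = 1"
  by (metis mult_1_left mult_1_right star_mult star_star)

lemma star_scaleR: "star (r *\<^sub>R x) = r *\<^sub>R star (x::'a::unital_cstar_algebra)"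
  by (simp add: scaleR_eq_scaleC star_scaleC)

lemma norm_star [simp]: "norm (star x) = norm (x::'a::unital_cstar_algebra)"
proof -
  have le: "norm y \<le> norm (star y)" for y :: 'a
  proof (cases "y = 0")
    case False
    have "norm y * norm y \<le> norm (star y) * norm y"
      using cstar_identity[of y] norm_mult_ineq[of "star y" y] by (simp add: power2_eq_square)
    then show ?thesis using False by simp
  qed simp
  show ?thesis using le[of x] le[of "star x"] by (simp add: star_star)
qed

lemma star_tendsto:
  assumes "f \<longlonglongrightarrow> (l::'a::unital_cstar_algebra)"
  shows "(\<lambda>n. star (f n)) \<longlonglongrightarrow> star l"
proof -
  have "(\<lambda>n. norm (f n - l)) \<longlonglongrightarrow> 0" using assms by (simp add: tendsto_norm_zero_iff LIM_zero_iff)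
  then have "(\<lambda>n. norm (star (f n) - star l)) \<longlonglongrightarrow> 0" by (simp flip: star_diff)
  then show ?thesis by (simp add: tendsto_norm_zero_iff LIM_zero_iff)
qed

text \<open>
  If \<open>norm y \<le> 1\<close>, the iterates converge to a solution \<open>b\<close> of \<open>b = (y + b\<^sup>2)/2\<close>, that is, of
  \<open>(1 - b)\<^sup>2 = 1 - y\<close>. They are polynomials in \<open>y\<close> with nonnegative coefficients, so the iterates
  for the real number \<open>1\<close> dominate all the norms. In contrast to the spectral approach this
  needs no functional calculus, and it covers the boundary case \<open>norm y = 1\<close>.
\<close>

primrec sqrt_iter :: "'a::real_normed_algebra_1 \<Rightarrow> nat \<Rightarrow> 'a" where
  "sqrt_iter y 0 = 0"
| "sqrt_iter y (Suc n) = (1/2) *\<^sub>R (y + sqrt_iter y n * sqrt_iter y n)"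

lemma sqrt_iter_commute: "z * y = y * z \<Longrightarrow> z * sqrt_iter y n = sqrt_iter y n * z"
proof (induction n)
  case (Suc n)
  have "z * (sqrt_iter y n * sqrt_iter y n) = sqrt_iter y n * sqrt_iter y n * z"
    using Suc by (metis mult.assoc)
  then show ?case using Suc.prems by (simp add: distrib_left distrib_right)
qed simp

lemma sqrt_iter_real: "0 \<le> sqrt_iter (1::real) n \<and> sqrt_iter (1::real) n \<le> 1"
proof (induction n)
  case (Suc n)
  then have "sqrt_iter (1::real) n * sqrt_iter (1::real) n \<le> 1" by (simp add: mult_le_one)
  then show ?case by simp
qed simp

lemma sqrt_iter_real_mono: "sqrt_iter (1::real) n \<le> sqrt_iter 1 (Suc n)"
proof -
  have "sqrt_iter 1 (Suc n) - sqrt_iter (1::real) n = (1 - sqrt_iter 1 n)\<^sup>2 / 2"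
    by (simp add: power2_eq_square algebra_simps)
  then show ?thesis by (metis diff_ge_0_iff_ge divide_nonneg_pos zero_le_power2 zero_less_numeral)
qed

lemma sqrt_iter_norm:
  assumes "norm y \<le> 1"
  shows "norm (sqrt_iter y n) \<le> sqrt_iter 1 n"
proof (induction n)
  case (Suc n)
  have "norm (sqrt_iter y n * sqrt_iter y n) \<le> sqrt_iter 1 n * sqrt_iter 1 n"
    using norm_mult_ineq mult_mono[OF Suc Suc] sqrt_iter_real[of n] norm_ge_zero
    by (meson order_trans)
  then show ?case using norm_triangle_ineq[of y "sqrt_iter y n * sqrt_iter y n"] assms
    by simp
qed simp

text \<open>
  The differences on both sides obey the recursion that comes from \<open>u\<^sup>2 - v\<^sup>2 = (u - v) (u + v)\<close> for commuting
  \<open>u\<close> and \<open>v\<close>.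
\<close>

lemma sqrt_iter_norm_diff:
  assumes "norm y \<le> 1"
  shows "norm (sqrt_iter y (Suc n) - sqrt_iter y n) \<le> sqrt_iter 1 (Suc n) - sqrt_iter 1 n"
proof (induction n)
  case (Suc n)
  let ?b = "sqrt_iter y" and ?\<beta> = "sqrt_iter (1::real)"
  have comm: "?b n * ?b (Suc n) = ?b (Suc n) * ?b n"
    by (intro sqrt_iter_commute sqrt_iter_commute[symmetric]) simp
  have "?b (Suc (Suc n)) - ?b (Suc n) = (1/2) *\<^sub>R (?b (Suc n) * ?b (Suc n) - ?b n * ?b n)"
    unfolding sqrt_iter.simps(2)[of y "Suc n"] sqrt_iter.simps(2)[of y n]
    by (simp flip: sqrt_iter.simps(2) add: scaleR_diff_right scaleR_add_right)
  also have "?b (Suc n) * ?b (Suc n) - ?b n * ?b n = (?b (Suc n) - ?b n) * (?b (Suc n) + ?b n)"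
    using comm by (simp only: distrib_left distrib_right left_diff_distrib) simp
  finally have "norm (?b (Suc (Suc n)) - ?b (Suc n))
      = 1/2 * norm ((?b (Suc n) - ?b n) * (?b (Suc n) + ?b n))" by simp
  also have "\<dots> \<le> 1/2 * ((?\<beta> (Suc n) - ?\<beta> n) * (?\<beta> (Suc n) + ?\<beta> n))"
  proof -
    have "norm (?b (Suc n) + ?b n) \<le> ?\<beta> (Suc n) + ?\<beta> n"
      using sqrt_iter_norm[OF assms, of n] sqrt_iter_norm[OF assms, of "Suc n"]
      by (meson add_mono norm_triangle_le)
    then have "norm (?b (Suc n) - ?b n) * norm (?b (Suc n) + ?b n)
        \<le> (?\<beta> (Suc n) - ?\<beta> n) * (?\<beta> (Suc n) + ?\<beta> n)"
      using Suc sqrt_iter_real_mono[of n] by (intro mult_mono) auto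
    then show ?thesis
      using norm_mult_ineq[of "?b (Suc n) - ?b n" "?b (Suc n) + ?b n"] by linarith
  qed
  also have "\<dots> = ?\<beta> (Suc (Suc n)) - ?\<beta> (Suc n)"
    unfolding sqrt_iter.simps(2)[of "1::real" "Suc n"] by (simp add: field_simps)
  finally show ?case .
qed (use assms in simp)

lemma sqrt_exists:
  fixes y :: "'a::unital_cstar_algebra"
  assumes y: "norm (1 - y) \<le> 1" and sa: "star y = y"
  obtains c where "c * c = y" "star c = c" "norm (1 - c) \<le> 1"
    "\<And>z. z * y = y * z \<Longrightarrow> z * c = c * z"
proof -
  let ?b = "sqrt_iter (1 - y)" and ?\<beta> = "sqrt_iter (1::real)"
  have "convergent ?\<beta>"
  proof (rule Bseq_mono_convergent)
    show "Bseq ?\<beta>" using sqrt_iter_real by (intro BseqI'[of _ 1]) auto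
    show "\<forall>m. \<forall>n\<ge>m. ?\<beta> m \<le> ?\<beta> n" 
      using lift_Suc_mono_le[of ?\<beta>, OF sqrt_iter_real_mono] by blast
  qed
  then obtain l where "?\<beta> \<longlonglongrightarrow> l" unfolding convergent_def by auto
  then have "summable (\<lambda>n. ?\<beta> (Suc n) - ?\<beta> n)" by (rule telescope_summable)
  then have "summable (\<lambda>n. ?b (Suc n) - ?b n)"
    by (rule summable_comparison_test') (use sqrt_iter_norm_diff[OF y] in blast)
  from summable_LIMSEQ[OF this] have "?b \<longlonglongrightarrow> (\<Sum>n. ?b (Suc n) - ?b n)"
    by (simp only: sum_lessThan_telescope) simp
  then obtain b where b: "?b \<longlonglongrightarrow> b" by blast
  have "(\<lambda>n. ?b (Suc n)) \<longlonglongrightarrow> (1/2) *\<^sub>R ((1 - y) + b * b)"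
    unfolding sqrt_iter.simps by (intro tendsto_intros b)
  then have "b = (1/2) *\<^sub>R ((1 - y) + b * b)"
    using b LIMSEQ_unique LIMSEQ_Suc by blast
  then have "2 *\<^sub>R b = 1 - y + b * b" by (metis scaleR_half_double scaleR_2 scaleR_scaleR
     mult.commute nonzero_divide_eq_eq scaleR_one zero_neq_numeral)
  then have sq: "(1 - b) * (1 - b) = y" by (simp add: algebra_simps scaleR_2)
  have nb: "norm b \<le> 1"
    using sqrt_iter_norm[OF y] sqrt_iter_real
    by (intro tendsto_upperbound[OF tendsto_norm[OF b]] always_eventually) (auto intro: order_trans)
  have "star (?b n) = ?b n" for n
    by (induction n) (simp_all add: star_scaleR star_add star_diff star_mult sa)
  then have sb: "star b = b" using star_tendsto[OF b] b LIMSEQ_unique by simp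
  have comm: "z * b = b * z" if "z * y = y * z" for z
  proof (rule LIMSEQ_unique)
    show "(\<lambda>n. z * ?b n) \<longlonglongrightarrow> z * b" by (intro tendsto_intros b)
    have "z * ?b n = ?b n * z" for n
      using that by (intro sqrt_iter_commute) (simp add: algebra_simps)
    then show "(\<lambda>n. z * ?b n) \<longlonglongrightarrow> b * z" by (simp add: tendsto_mult_right b)
  qed
  show ?thesis
  proof (rule that[of "1 - b"])
    show "z * (1 - b) = (1 - b) * z" if "z * y = y * z" for z
      using comm[OF that] by (simp add: right_diff_distrib left_diff_distrib)
  qed (simp_all add: sq nb sb star_diff)
qed

lemma scaleC_i_i: "\<i> *\<^sub>C \<i> *\<^sub>C x = - (x::'a::unital_cstar_algebra)"
  using scaleR_eq_scaleC[of "-1" x] by (simp add: scaleC_scaleC)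

lemma scaleC_minus_left: "(- c) *\<^sub>C x = - (c *\<^sub>C (x::'a::unital_cstar_algebra))"
  using scaleR_eq_scaleC[of "-1" "c *\<^sub>C x"] by (simp add: scaleC_scaleC)

lemma scaleC_minus_right: "c *\<^sub>C (- x) = - (c *\<^sub>C (x::'a::unital_cstar_algebra))"
  using scaleR_eq_scaleC[of "-1" "c *\<^sub>C x"] scaleR_eq_scaleC[of "-1" "x"]
  by (simp add: scaleC_scaleC)

lemma scaleC_diff_right: "c *\<^sub>C (x - y) = c *\<^sub>C x - c *\<^sub>C (y::'a::unital_cstar_algebra)"
  using scaleC_add_right[of c x "- y"] by (simp add: scaleC_minus_right)

text \<open>
  For commuting self-adjoint \<open>a\<close> and \<open>b\<close> the element \<open>a + \<i> b\<close> is normal and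
  \<open>a\<^sup>2 + b\<^sup>2\<close> is its squared modulus, so the \<open>C\<^sup>*\<close>-identity applies to it. This replaces
  positivity arguments in what follows.
\<close>

lemma norm_complex_comb:
  fixes a b :: "'a::unital_cstar_algebra"
  assumes "star a = a" "star b = b" "a * b = b * a"
  shows "(norm (a + \<i> *\<^sub>C b))\<^sup>2 = norm (a * a + b * b)"
proof -
  have "star (a + \<i> *\<^sub>C b) * (a + \<i> *\<^sub>C b) = a * a + b * b"
    using assms
    by (simp add: star_add star_scaleC scaleC_minus_left distrib_left distrib_right
      left_diff_distrib scaleC_add_right scaleC_diff_right mult_scaleC_left mult_scaleC_right scaleC_i_i)
  then show ?thesis using cstar_identity by metis
qed

lemma norm_le_complex_comb:
  fixes a b :: "'a::unital_cstar_algebra"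
  assumes "star a = a" "star b = b"
  shows "norm a \<le> norm (a + \<i> *\<^sub>C b)"
proof -
  let ?u = "a + \<i> *\<^sub>C b"
  have "?u + star ?u = 2 *\<^sub>R a"
    using assms by (simp add: star_add star_scaleC scaleC_minus_left scaleR_2)
  then have "2 * norm a \<le> norm ?u + norm (star ?u)"
    using norm_triangle_ineq[of ?u "star ?u"] by simp
  then show ?thesis by simp
qed

lemma sum_squares_eq_1_norm:
  fixes a b :: "'a::unital_cstar_algebra"
  assumes "star a = a" "star b = b" "a * b = b * a" "a * a + b * b = 1"
  shows "norm a \<le> 1"
  using norm_complex_comb[OF assms(1-3)] norm_le_complex_comb[OF assms(1,2)] assms(4)
  by (simp add: power2_eq_1_iff) (smt (verit) norm_ge_zero)

lemma sum_squares_eq_0: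
  fixes a b :: "'a::unital_cstar_algebra"
  assumes "star a = a" "star b = b" "a * b = b * a" "a * a + b * b = 0"
  shows "a = 0"
  using norm_complex_comb[OF assms(1-3)] norm_le_complex_comb[OF assms(1,2)] assms(4)
  by simp

text \<open>
  With \<open>c\<close> the square root of \<open>1 - a\<^sup>2\<close>, the element \<open>c + \<i> a\<close> is unitary. Hence
  \<open>norm c \<le> 1\<close>.
\<close>

lemma norm_one_minus_square:
  fixes a :: "'a::unital_cstar_algebra"
  assumes a: "star a = a" "norm a \<le> 1"
  shows "norm (1 - a * a) \<le> 1"
proof -
  have le: "x * x \<le> 1" if "0 \<le> x" "x \<le> 1" for x :: real using that by (simp add: mult_le_one)
  have "norm (a * a) \<le> 1"
    using le[OF norm_ge_zero a(2)] norm_mult_ineq[of a a] by linarith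
  then have "norm (1 - (1 - a * a)) \<le> 1" by simp
  moreover have "star (1 - a * a) = 1 - a * a" by (simp add: star_diff star_mult a(1))
  moreover have "a * (1 - a * a) = (1 - a * a) * a" by (simp add: algebra_simps)
  ultimately obtain c where c: "c * c = 1 - a * a" "star c = c" "a * c = c * a"
    using sqrt_exists[of "1 - a * a"] by blast
  then have "norm c \<le> 1"
    by (intro sum_squares_eq_1_norm[of c a]) (simp_all only: a(1) diff_add_cancel)
  then show ?thesis
    using le[OF norm_ge_zero] norm_mult_ineq[of c c] c(1) by (metis order_trans)
qed

text \<open>
  The hypotheses provide commuting self-adjoint square roots of \<open>x\<close> and of \<open>- x\<close>, whose squares
  add up to \<open>0\<close>.
\<close>

lemma ball_two_sides_zero:
  fixes x :: "'a::unital_cstar_algebra"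
  assumes "star x = x" "norm (1 - x) \<le> 1" "norm (1 + x) \<le> 1"
  shows "x = 0"
proof -
  obtain c where c: "c * c = x" "star c = c"
    using sqrt_exists[OF assms(2,1)] by blast
  have "c * (- x) = (- x) * c" by (simp flip: c(1) add: mult.assoc)
  moreover have "norm (1 - (- x)) \<le> 1" "star (- x) = - x"
    using assms(1,3) by (simp_all add: star_minus)
  ultimately obtain c' where c': "c' * c' = - x" "star c' = c'" "c * c' = c' * c"
    using sqrt_exists[of "- x"] by blast
  have "c = 0" by (rule sum_squares_eq_0[OF c(2) c'(2,3)]) (simp add: c(1) c'(1))
  then show ?thesis using c(1) by simp
qed

text \<open>
  Let \<open>m\<close> be the square root of \<open>x\<^sup>2\<close>. From \<open>(m - x) (m + x) = 0\<close> and the absence of zero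
  divisors, \<open>x\<close> or \<open>- x\<close> equals \<open>m\<close>, so it lies in the unit ball around \<open>1\<close>. Apply this to
  \<open>b - t\<close> for every \<open>t\<close> in an interval: the two alternatives are closed conditions on \<open>t\<close>, and
  each holds at one end. By connectedness both hold for some \<open>t\<close>, and then \<open>b = t\<close>.
\<close>

lemma selfadjoint_scalar:
  fixes a :: "'a::unital_cstar_algebra"
  assumes nzd: "\<And>c d :: 'a. d * c = 0 \<Longrightarrow> c = 0 \<or> d = 0"
    and a: "star a = a"
  obtains t where "a = t *\<^sub>R 1"
proof -
  have dich: "norm (1 - x) \<le> 1 \<or> norm (1 + x) \<le> 1" if x: "star x = x" "norm x \<le> 1" for x :: 'a
  proof -
    have "x * (x * x) = (x * x) * x" by (simp add: mult.assoc)
    then obtain m where m: "m * m = x * x" "norm (1 - m) \<le> 1" "x * m = m * x"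
      using sqrt_exists[of "x * x"] norm_one_minus_square[OF x] x by (metis star_mult)
    have "(m - x) * (m + x) = 0" using m by (simp add: algebra_simps)
    then have "m = x \<or> m = - x" using nzd by (metis eq_iff_diff_eq_0 eq_neg_iff_add_eq_0)
    then show ?thesis using m(2) by auto
  qed
  define b where "b = (1 / (2 * norm a + 1)) *\<^sub>R a"
  have b: "star b = b" using a by (simp add: b_def star_scaleR)
  have pos: "2 * norm a + 1 > 0" using norm_ge_zero[of a] by linarith
  have nb: "norm b \<le> 1/2"
    using pos by (simp add: b_def divide_simps)
  define T1 where "T1 = {t::real. norm (1 - (b - t *\<^sub>R 1)) \<le> 1}"
  define T2 where "T2 = {t::real. norm (1 + (b - t *\<^sub>R 1)) \<le> 1}"
  have cl: "closed T1" "closed T2"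
    unfolding T1_def T2_def by (auto intro!: closed_Collect_le continuous_intros)
  have one_sided: "(1 - (1/2) *\<^sub>R 1 :: 'a) = (1/2) *\<^sub>R 1"
    by (metis add_diff_cancel_left' scaleR_half_double scaleR_right_distrib)
  have ends: "- (1/2) \<in> T1" "1/2 \<in> T2"
  proof -
    have "1 - (b - (- (1/2)) *\<^sub>R 1) = (1/2) *\<^sub>R 1 - b" using one_sided by (simp add: algebra_simps)
    moreover have "norm ((1/2) *\<^sub>R 1 - b) \<le> 1"
      using nb norm_triangle_ineq4[of "(1/2) *\<^sub>R (1::'a)" b] by simp
    ultimately show "- (1/2) \<in> T1" unfolding T1_def by (metis mem_Collect_eq)
    have "1 + (b - (1/2) *\<^sub>R 1) = (1/2) *\<^sub>R 1 + b" using one_sided by (simp add: algebra_simps)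
    moreover have "norm ((1/2) *\<^sub>R 1 + b) \<le> 1"
      using nb norm_triangle_ineq[of "(1/2) *\<^sub>R (1::'a)" b] by simp
    ultimately show "1/2 \<in> T2" unfolding T2_def by (metis mem_Collect_eq)
  qed
  have cover: "{-(1/2)..1/2} \<subseteq> T1 \<union> T2"
  proof
    fix t :: real assume t: "t \<in> {-(1/2)..1/2}"
    have "norm (b - t *\<^sub>R 1) \<le> 1" using norm_triangle_ineq4[of b "t *\<^sub>R 1"] nb t by auto
    then show "t \<in> T1 \<union> T2"
      using dich[of "b - t *\<^sub>R 1"] b by (simp add: star_diff star_scaleR T1_def T2_def)
  qed
  have "T1 \<inter> T2 \<inter> {-(1/2)..1/2} \<noteq> {}"
  proof -
    have "- (1/2) \<in> {-(1/2)..1/2 :: real}" "1/2 \<in> {-(1/2)..1/2 :: real}" by auto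
    then have "T1 \<inter> {-(1/2)..1/2} \<noteq> {}" "T2 \<inter> {-(1/2)..1/2} \<noteq> {}" using ends by blast+
    then show ?thesis using connected_closedD[of "{-(1/2)..1/2}" T1 T2] cl cover connected_Icc by blast
  qed
  then obtain t where "t \<in> T1" "t \<in> T2" by blast
  then have "b - t *\<^sub>R 1 = 0"
    using b by (intro ball_two_sides_zero) (simp_all add: star_diff star_scaleR T1_def T2_def)
  then have "(2 * norm a + 1) *\<^sub>R b = (2 * norm a + 1) *\<^sub>R t *\<^sub>R 1" by simp
  moreover have "(2 * norm a + 1) *\<^sub>R b = a" using pos by (simp add: b_def)
  ultimately have "a = ((2 * norm a + 1) * t) *\<^sub>R 1" by simp
  then show ?thesis by (rule that)
qed

text \<open>
  Without zero divisors the real and imaginary parts of \<open>x\<close> would be scalar.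
\<close>

proposition noncommutative_imp_zero_divisors:
  fixes x y :: "'a::unital_cstar_algebra"
  assumes "x * y \<noteq> y * x"
  obtains c d :: 'a where "c \<noteq> 0" "d \<noteq> 0" "d * c = 0"
proof (rule ccontr)
  assume "\<not> thesis"
  with that have nzd: "\<And>c d :: 'a. d * c = 0 \<Longrightarrow> c = 0 \<or> d = 0" by blast
  obtain s where s: "x + star x = s *\<^sub>R 1"
    using selfadjoint_scalar[OF nzd, of "x + star x"] by (auto simp: star_add star_star add.commute)
  have "star (\<i> *\<^sub>C (x - star x)) = \<i> *\<^sub>C (x - star x)"
    by (simp add: star_scaleC star_diff star_star scaleC_minus_left flip: scaleC_minus_right)
  then obtain t where t: "\<i> *\<^sub>C (x - star x) = t *\<^sub>R 1"
    using selfadjoint_scalar[OF nzd] by blast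
  then have d: "x - star x = - (\<i> *\<^sub>C (t *\<^sub>R 1))" using scaleC_i_i[of "x - star x"] by simp
  have "2 *\<^sub>R x = s *\<^sub>R 1 - \<i> *\<^sub>C (t *\<^sub>R 1)"
    unfolding s[symmetric] using d by (simp add: scaleR_2 algebra_simps)
  then have "(2 *\<^sub>R x) * y = y * (2 *\<^sub>R x)"
    by (simp only: left_diff_distrib right_diff_distrib mult_scaleC_left mult_scaleC_right
      mult_scaleR_left mult_scaleR_right mult_1_left mult_1_right)
  then show False using assms by simp
qed

section \<open>Simple algebras as prime rings\<close>

locale simple_cstar =
  fixes A :: "'a::unital_cstar_algebra itself"
  assumes simple: "simple_cstar_algebra A"
begin

text \<open>
  The closure of the two-sided ideal generated by \<open>m\<close> is everything, so the ideal itself meets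
  the ball of invertibles around \<open>1\<close> and is everything too: simplicity holds in the algebraic
  sense. The induction rule avoids any mention of the finite sums that express
  an element by \<open>m\<close>.
\<close>

lemma full_induct:
  fixes m x :: 'a
  assumes m: "m \<noteq> 0"
    and gen: "\<And>a b. P (a * m * b)"
    and add: "\<And>x y. P x \<Longrightarrow> P y \<Longrightarrow> P (x + y)"
  shows "P x"
proof -
  define I where "I = {x. \<exists>xs. x = (\<Sum>(a, b)\<leftarrow>xs. a * m * b)}"
  have I0: "0 \<in> I" unfolding I_def by (auto intro!: exI[of _ "[]"])
  have Iadd: "x + y \<in> I" if xy: "x \<in> I" "y \<in> I" for x y
  proof -
    obtain xs ys where "x = (\<Sum>(a, b)\<leftarrow>xs. a * m * b)" "y = (\<Sum>(a, b)\<leftarrow>ys. a * m * b)"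
      using xy unfolding I_def by auto
    then have "x + y = (\<Sum>(a, b)\<leftarrow>xs @ ys. a * m * b)" by simp
    then show ?thesis unfolding I_def by blast
  qed
  have Ileft: "c * x \<in> I" if x: "x \<in> I" for c x
  proof -
    obtain xs where xs: "x = (\<Sum>(a, b)\<leftarrow>xs. a * m * b)" using x unfolding I_def by blast
    have "c * x = (\<Sum>(a, b)\<leftarrow>map (\<lambda>(a, b). (c * a, b)) xs. a * m * b)"
      unfolding xs by (induction xs) (auto simp: distrib_left mult.assoc)
    then show ?thesis unfolding I_def by blast
  qed
  have Iright: "x * c \<in> I" if x: "x \<in> I" for c x
  proof -
    obtain xs where xs: "x = (\<Sum>(a, b)\<leftarrow>xs. a * m * b)" using x unfolding I_def by blast
    have "x * c = (\<Sum>(a, b)\<leftarrow>map (\<lambda>(a, b). (a, b * c)) xs. a * m * b)"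
      unfolding xs by (induction xs) (auto simp: distrib_right mult.assoc)
    then show ?thesis unfolding I_def by blast
  qed
  have mI: "m \<in> I" unfolding I_def by (auto intro!: exI[of _ "[(1, 1)]"])
  have lim: "\<exists>f. (\<forall>n. f n \<in> I) \<and> f \<longlonglongrightarrow> x" if "x \<in> closure I" for x
    using that unfolding closure_sequential by blast
  have "closed_two_sided_ideal (closure I)"
    unfolding closed_two_sided_ideal_def
  proof (intro conjI ballI allI)
    show "0 \<in> closure I" using I0 closure_subset by blast
    fix x assume "x \<in> closure I"
    then obtain f where f: "\<And>n. f n \<in> I" "f \<longlonglongrightarrow> x" using lim by blast
    have left: "a * x \<in> closure I" for a
      unfolding closure_sequential
      by (rule exI[of _ "\<lambda>n. a * f n"]) (auto intro!: Ileft f tendsto_intros)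
    show "a * x \<in> closure I" for a by (rule left)
    show "x * a \<in> closure I" for a
      unfolding closure_sequential
      by (rule exI[of _ "\<lambda>n. f n * a"]) (auto intro!: Iright f tendsto_intros)
    show "c *\<^sub>C x \<in> closure I" for c
      using left[of "c *\<^sub>C 1"] by (simp add: mult_scaleC_left)
    fix y assume "y \<in> closure I"
    then obtain g where g: "\<And>n. g n \<in> I" "g \<longlonglongrightarrow> y" using lim by blast
    show "x + y \<in> closure I"
      unfolding closure_sequential
      by (rule exI[of _ "\<lambda>n. f n + g n"]) (auto intro!: Iadd f g tendsto_intros)
  qed simp
  then have "closure I = UNIV"
    using simple mI m closure_subset[of I] unfolding simple_cstar_algebra_def by blast
  then obtain i where i: "i \<in> I" "dist i 1 < 1"
    using closure_approachable[of 1 I] zero_less_one by blast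
  then have "norm (1 - i) < 1" by (simp add: dist_norm norm_minus_commute)
  from neumann_right[OF this] have "i * neumann (1 - i) = 1" by simp
  then have "1 \<in> I" using Iright[OF i(1)] by metis
  then have "x \<in> I" using Ileft[of 1 x] by simp
  then obtain xs where xs: "x = (\<Sum>(a, b)\<leftarrow>xs. a * m * b)" unfolding I_def by auto
  have P0: "P 0" using gen[of 0 0] by simp
  have "P (\<Sum>(a, b)\<leftarrow>xs. a * m * b)" for xs
    by (induction xs) (auto intro: P0 gen add)
  then show ?thesis using xs by simp
qed

lemma prime:
  fixes x y :: 'a
  assumes "x \<noteq> 0" "y \<noteq> 0"
  obtains a where "x * a * y \<noteq> 0"
proof (rule ccontr)
  assume "\<not> thesis"
  with that have *: "x * a * y = 0" for a by blast
  have "x * z = 0" for z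
    by (rule full_induct[OF assms(2)]) (use * in \<open>auto simp: distrib_left mult.assoc[symmetric]\<close>)
  from this[of 1] show False using assms(1) by simp
qed

lemma primeD:
  fixes x y :: 'a
  assumes "\<And>a. x * a * y = 0"
  shows "x = 0 \<or> y = 0"
  using assms prime by blast

lemma central_mult_eq_0:
  assumes "z \<in> algebra_center" "z * x = 0" "x \<noteq> (0::'a)" shows "z = 0"
proof -
  have "z * a * x = 0" for a
    using assms(1,2) unfolding algebra_center_def by (metis (mono_tags, lifting) mem_Collect_eq mult.assoc mult_zero_right)
  then show ?thesis using primeD assms(3) by blast
qed

text \<open>
  Writing \<open>1\<close> as a sum of products \<open>u q v\<close> gives the candidate \<open>l\<close>, the corresponding sum of
  the \<open>u s v\<close>; it satisfies \<open>p a = r a l\<close> for all \<open>a\<close>. Primeness then makes \<open>l\<close> central.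
  This says that the extended centroid of a simple unital ring is its centre.
\<close>

lemma extended_centroid:
  fixes p q r s :: 'a
  assumes eq: "\<And>a. p * a * q = r * a * s" and q: "q \<noteq> 0" and r: "r \<noteq> 0"
  obtains l where "l \<in> algebra_center" "p = l * r" "s = l * q"
proof -
  have "\<exists>l. \<forall>a. p * a * x = r * a * l" for x
  proof (rule full_induct[OF q, where P = "\<lambda>x. \<exists>l. \<forall>a. p * a * x = r * a * l"])
    fix u v
    have "p * a * (u * q * v) = r * a * (u * s * v)" for a
      using arg_cong[OF eq[of "a * u"], of "\<lambda>x. x * v"] by (simp add: mult.assoc)
    then show "\<exists>l. \<forall>a. p * a * (u * q * v) = r * a * l" by blast
  next
    fix x y assume "\<exists>l. \<forall>a. p * a * x = r * a * l" "\<exists>l. \<forall>a. p * a * y = r * a * l"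
    then obtain l l' where "\<forall>a. p * a * x = r * a * l" "\<forall>a. p * a * y = r * a * l'" by blast
    then have "\<forall>a. p * a * (x + y) = r * a * (l + l')" by (simp add: distrib_left)
    then show "\<exists>l. \<forall>a. p * a * (x + y) = r * a * l" by blast
  qed
  from this[of 1] obtain l where l: "\<And>a. p * a = r * a * l" by auto
  have "l * b = b * l" for b
  proof -
    have "r * a * (l * b - b * l) = 0" for a
      using l[of a] l[of "a * b"] by (simp add: right_diff_distrib mult.assoc[symmetric])
    then show ?thesis using primeD[of r "l * b - b * l"] r by auto
  qed
  then have c: "l \<in> algebra_center" unfolding algebra_center_def by blast
  have "p = l * r" using l[of 1] c unfolding algebra_center_def by simp
  moreover have "s = l * q"
  proof -
    have "r * a * (l * q - s) = 0" for a
      using eq[of a] l[of a] by (simp add: right_diff_distrib mult.assoc[symmetric])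
    then show ?thesis using primeD[of r "l * q - s"] r by auto
  qed
  ultimately show ?thesis using c that by blast
qed

lemma central_invertible:
  assumes z: "z \<in> algebra_center" "z \<noteq> (0::'a)"
  obtains y where "y \<in> algebra_center" "y * z = 1"
proof -
  have "\<exists>y. y * z = x" for x
  proof (rule full_induct[OF z(2), where P = "\<lambda>x. \<exists>y. y * z = x"])
    fix a b
    have "(a * b) * z = a * z * b" using z(1) unfolding algebra_center_def by (simp add: mult.assoc)
    then show "\<exists>y. y * z = a * z * b" by blast
  qed (metis distrib_right)
  then obtain y where y: "y * z = 1" by blast
  have "y * a = a * y" for a
  proof -
    have zc: "z * b = b * z" for b using z(1) unfolding algebra_center_def by blast
    have "y * a = y * a * (z * y)" using y zc by simp
    also have "\<dots> = y * (a * z) * y" by (simp add: mult.assoc)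
    also have "\<dots> = y * z * (a * y)" by (simp add: mult.assoc flip: zc[of a])
    finally show ?thesis using y by simp
  qed
  then show ?thesis using that y unfolding algebra_center_def by blast
qed

text \<open>
  The hypothesis makes \<open>J\<close> a kind of Jordan ideal, and the claim is in the spirit of Herstein's
  theorem that Jordan ideals of simple rings are trivial. Suitable differences of the given
  generators show that \<open>J\<close> contains the left ideal generated by the commutators
  \<open>\<Theta> X Y = P X P Y - P Y P X\<close>, and then the two-sided ideals generated by the elements
  \<open>\<Theta> X Y P\<close>. This settles the matter unless all \<open>\<Theta> X Y P\<close> vanish. In that case, which
  does occur, for instance for two-by-two matrices and \<open>P\<close> of rank one, the extended centroid
  shows that \<open>P X P\<close> is always a central multiple of \<open>P\<close>, as for a rank one matrix, and a direct
  computation applies.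
\<close>

lemma jordan_span_full:
  fixes P Q :: 'a and J :: "'a set"
  assumes P: "P \<noteq> 0" and Q: "Q \<noteq> 0"
    and J0: "0 \<in> J" and Jdiff: "\<And>x y. x \<in> J \<Longrightarrow> y \<in> J \<Longrightarrow> x - y \<in> J"
    and F: "\<And>b e b'. b * P * e * Q * b' + b' * P * e * Q * b \<in> J"
  shows "x \<in> J"
proof -
  have Jneg: "- x \<in> J" if "x \<in> J" for x using Jdiff[OF J0 that] by simp
  have Jadd: "x + y \<in> J" if "x \<in> J" "y \<in> J" for x y
    using Jdiff[OF that(1) Jneg[OF that(2)]] by simp
  define \<Theta> where "\<Theta> X Y = P * X * P * Y - P * Y * P * X" for X Y
  have L1: "b' * \<Theta> X Y \<in> J" for b' X Y
  proof -
    \<comment> \<open>The two generators share their first product, which cancels.\<close>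
    have *: "b' * \<Theta> (e * Q * t) (e' * Q * b) \<in> J" for e t e' b
      using Jdiff[OF F[of b "e * Q * t * P * e'" b'] F[of "b * P * e * Q * t" e' b']]
      by (simp add: \<Theta>_def algebra_simps)
    have "b' * \<Theta> (e * Q * t) Y \<in> J" for e t
      by (rule full_induct[OF Q, where P = "\<lambda>Y. b' * \<Theta> (e * Q * t) Y \<in> J"], rule *)
         (drule (1) Jadd, simp add: \<Theta>_def algebra_simps)
    then show ?thesis
      by (rule full_induct[OF Q, where P = "\<lambda>X. b' * \<Theta> X Y \<in> J"])
         (drule (1) Jadd, simp add: \<Theta>_def algebra_simps)
  qed
  have L2: "b' * (\<Theta> X X' * P) * R \<in> J" for b' X X' R
  proof -
    \<comment> \<open>For this choice \<open>P * ?X\<close> is itself of the form \<open>\<Theta> X X'\<close>, which the left ideal absorbs.\<close>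
    let ?X = "X * P * X' - X' * P * X"
    have th: "P * ?X = \<Theta> X X'" by (simp add: \<Theta>_def algebra_simps)
    have "\<Theta> ?X R = \<Theta> X X' * P * R - P * R * \<Theta> X X'"
      unfolding \<Theta>_def[of ?X R] th mult.assoc[of "P * R" P ?X] by simp
    then have "b' * (\<Theta> X X' * P) * R = b' * \<Theta> ?X R + b' * P * R * \<Theta> X X'"
      by (simp add: distrib_left right_diff_distrib mult.assoc)
    then show ?thesis using Jadd[OF L1[of b' ?X R] L1[of "b' * P * R" X X']] by simp
  qed
  show ?thesis
  proof (cases "\<exists>X X'. \<Theta> X X' * P \<noteq> 0")
    case True
    then obtain X X' where m: "\<Theta> X X' * P \<noteq> 0" by blast
    show ?thesis by (rule full_induct[OF m, where P = "\<lambda>x. x \<in> J"]) (rule L2, rule Jadd)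
  next
    case False
    have minP: "\<exists>l\<in>algebra_center. P * X * P = l * P" for X
    proof (cases "P * X * P = 0")
      case True
      then show ?thesis by (intro bexI[of _ 0]) (auto simp: algebra_center_def)
    next
      case nz: False
      have "(P * X * P) * a * P = P * a * (P * X * P)" for a
        using False by (simp add: \<Theta>_def algebra_simps)
      from extended_centroid[OF this P P] show ?thesis by metis
    qed
    obtain e where m: "P * e * Q \<noteq> 0" using prime[OF P Q] by blast
    define m where "m = P * e * Q"
    have F': "b * m * b' + b' * m * b \<in> J" for b b'
      using F[of b e b'] by (simp add: m_def mult.assoc)
    have "\<exists>l\<in>algebra_center. m * X * m = l * m" for X
      using minP[of "e * Q * X"] by (metis m_def mult.assoc)
    then obtain \<mu> where \<mu>: "\<And>X. \<mu> X \<in> algebra_center" "\<And>X. m * X * m = \<mu> X * m" by metis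
    have \<mu>c: "\<mu> X * a = a * \<mu> X" for X a using \<mu>(1)[of X] unfolding algebra_center_def by blast
    obtain y0 where y0: "m * y0 * m \<noteq> 0" using prime m m_def by metis
    then have "\<mu> y0 \<noteq> 0" using \<mu>(2)[of y0] by auto
    then obtain k where k: "k \<in> algebra_center" "k * \<mu> y0 = 1" using central_invertible[OF \<mu>(1)] by metis
    have kc: "k * a = a * k" for a using k(1) unfolding algebra_center_def by blast
    \<comment> \<open>\<open>m * y\<close> is an idempotent.\<close>
    define y where "y = k * y0"
    have my: "m * y * m = m"
    proof -
      have "m * y * m = k * (m * y0 * m)" unfolding y_def by (metis kc mult.assoc)
      then show ?thesis using \<mu>(2)[of y0] k(2) by (metis mult.assoc mult_1_left)
    qed
    have core: "b1 * m * b2 * m * b' + b' * m * b1 * m * b2 \<in> J" for b1 b2 b'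
      using F'[of "b1 * m * b2" b'] by (simp add: mult.assoc)
    have R: "b1 * m * b' \<in> J" if "m * b1 * m = 0" for b1 b'
    proof -
      have "b1 * m * y * m * b' + b' * m * b1 * m * y = b1 * (m * y * m) * b' + b' * (m * b1 * m) * y"
        by (simp add: mult.assoc)
      then show ?thesis using core[of b1 y b'] my that by simp
    qed
    have R': "b' * m * b2 \<in> J" if "m * b2 * m = 0" for b2 b'
    proof -
      have "y * m * b2 * m * b' + b' * m * y * m * b2 = y * (m * b2 * m) * b' + b' * (m * y * m) * b2"
        by (simp add: mult.assoc)
      then show ?thesis using core[of y b2 b'] my that by simp
    qed
    have red: "m * (b - \<mu> b * y) * m = 0" for b
    proof -
      have "m * (\<mu> b * y) * m = \<mu> b * (m * y * m)" by (metis \<mu>c mult.assoc)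
      then show ?thesis using my \<mu>(2)[of b] by (simp add: right_diff_distrib left_diff_distrib)
    qed
    \<comment> \<open>Split off the multiple of \<open>y\<close> from each factor; the remainders are killed by \<open>m\<close> on both sides.\<close>
    have "b * m * b' \<in> J" for b b'
    proof -
      have e: "b * m * b' = (b - \<mu> b * y) * m * b' + (\<mu> b * y) * m * (b' - \<mu> b' * y)
          + (\<mu> b * y) * m * (\<mu> b' * y)"
        by (simp add: algebra_simps)
      have "(\<mu> b * y) * m * (\<mu> b' * y) = ((1/2) *\<^sub>R (\<mu> b' * \<mu> b * y)) * m * y + y * m * ((1/2) *\<^sub>R (\<mu> b' * \<mu> b * y))"
      proof -
        have "(\<mu> b * y) * m * (\<mu> b' * y) = \<mu> b' * (\<mu> b * (y * m * y))" by (metis \<mu>c mult.assoc)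
        moreover have "y * m * (\<mu> b' * \<mu> b * y) = \<mu> b' * (\<mu> b * (y * m * y))" by (metis \<mu>c mult.assoc)
        moreover have "(\<mu> b' * \<mu> b * y) * m * y = \<mu> b' * (\<mu> b * (y * m * y))" by (simp add: mult.assoc)
        ultimately show ?thesis by (simp add: scaleR_half_double flip: scaleR_add_right)
      qed
      then have "(\<mu> b * y) * m * (\<mu> b' * y) \<in> J" using F' by metis
      then show ?thesis unfolding e by (intro Jadd[OF Jadd[OF R[OF red] R'[OF red]]])
    qed
    moreover have "m \<noteq> 0" using m m_def by simp
    ultimately show ?thesis using full_induct[of m "\<lambda>x. x \<in> J"] Jadd by metis
  qed
qed

end

section \<open>Root elements in a subgroup normalized by commutators\<close>

lemma small_scale:
  fixes x :: "'a::real_normed_vector"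
  assumes "\<delta> > 0"
  obtains t :: real where "t > 0" "norm (t *\<^sub>R x) < \<delta>"
proof -
  have pos: "norm x + 1 > 0" using norm_ge_zero[of x] by linarith
  have "\<delta> * norm x < \<delta> * (norm x + 1)" using assms by simp
  then have "norm ((\<delta> / (norm x + 1)) *\<^sub>R x) < \<delta>"
    using assms pos by (simp add: divide_simps)
  then show ?thesis using that[of "\<delta> / (norm x + 1)"] assms pos by simp
qed

lemma
  assumes "subgroup S GA"
  shows sub_one: "1 \<in> S" and sub_mult: "x \<in> S \<Longrightarrow> y \<in> S \<Longrightarrow> x * y \<in> S"
    and sub_iv: "x \<in> S \<Longrightarrow> iv x \<in> S" and sub_G: "x \<in> S \<Longrightarrow> x \<in> G"
  using subgroup.one_closed[OF assms] subgroup.m_closed[OF assms] subgroup.m_inv_closed[OF assms]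
    subgroup.mem_carrier[OF assms] by simp_all

lemma subgroup_GA_I:
  assumes "S \<subseteq> G" "1 \<in> S" "\<And>x y. x \<in> S \<Longrightarrow> y \<in> S \<Longrightarrow> x * y \<in> S" "\<And>x. x \<in> S \<Longrightarrow> iv x \<in> S"
  shows "subgroup S GA"
  using assms by (intro GA.subgroupI) auto

lemma iv_mult: "x \<in> G \<Longrightarrow> y \<in> G \<Longrightarrow> iv (x * y) = iv y * iv x"
  using GA.inv_mult_group by simp

lemma iv_iv: "x \<in> G \<Longrightarrow> iv (iv x) = x" by simp

lemma iv_cancel:
  assumes "x \<in> G"
  shows "iv x * x = 1" "x * iv x = 1" "iv x * (x * z) = z" "x * (iv x * z) = z"
  using iv_left[OF assms] iv_right[OF assms] by (simp_all flip: mult.assoc)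

lemma K_eq: "K = derived GA G" by (simp add: comm_GA_def)

lemma K_subgroup: "subgroup K GA"
  unfolding K_eq by (rule GA.derived_is_subgroup) simp

lemma commutator_in_K: "x \<in> G \<Longrightarrow> y \<in> G \<Longrightarrow> x * y * iv x * iv y \<in> K"
  unfolding K_eq derived_def by (rule generate.incl) (auto intro!: bexI)

lemma K_least:
  assumes "subgroup S GA" "\<And>x y. x \<in> G \<Longrightarrow> y \<in> G \<Longrightarrow> x * y * iv x * iv y \<in> S"
  shows "K \<subseteq> S"
  unfolding K_eq derived_def
  by (rule GA.generate_subgroup_incl[OF _ assms(1)]) (use assms(2) in auto)

lemma K_G: "x \<in> K \<Longrightarrow> x \<in> G" by (rule sub_G[OF K_subgroup])

lemma iv_square_zero: "x * x = 0 \<Longrightarrow> iv (1 + x) = 1 - x"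
  by (rule iv_eqI[OF square_zero_in_G]) (simp_all add: algebra_simps)

text \<open>
  It is convenient to keep only one inclusion of the normalization condition.
\<close>

definition commutator_normalized :: "'a::unital_cstar_algebra set \<Rightarrow> bool" where
  "commutator_normalized H \<longleftrightarrow> subgroup H GA \<and> (\<forall>k\<in>K. \<forall>h\<in>H. k * h * iv k \<in> H)"

lemma commutator_normalized_commutator:
  assumes "commutator_normalized H" "h \<in> H" "k \<in> K"
  shows "h * k * iv h * iv k \<in> H"
proof -
  have H: "subgroup H GA" using assms unfolding commutator_normalized_def by blast
  have "k * iv h * iv k \<in> H"
    using assms sub_iv[OF H] unfolding commutator_normalized_def by blast
  from sub_mult[OF H assms(2) this] show ?thesis by (simp add: mult.assoc)
qed

text \<open>
  For a null pair the products \<open>c a d\<close> have square zero and multiply to zero among each other.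
  The root elements \<open>1 + c a d\<close> form an abelian group, like the elementary matrices of a fixed
  position.
\<close>

definition null_pair :: "'a::unital_cstar_algebra \<Rightarrow> 'a \<Rightarrow> bool" where
  "null_pair c d \<longleftrightarrow> c \<noteq> 0 \<and> d \<noteq> 0 \<and> d * c = 0"

lemma null_pair_conj:
  assumes "null_pair c d" "g \<in> G"
  shows "null_pair (g * c) (d * iv g)"
proof -
  have "d * iv g * (g * c) = 0"
    using assms by (simp add: null_pair_def iv_cancel mult.assoc)
  moreover have "g * c \<noteq> 0" "d * iv g \<noteq> 0"
    using assms iv_cancel[OF assms(2)] by (metis mult_zero_right null_pair_def,
       metis mult.assoc mult_1_right mult_zero_left null_pair_def)
  ultimately show ?thesis unfolding null_pair_def by blast
qed

context simple_cstar
begin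

text \<open>
  If \<open>x = c a d\<close> and \<open>g = 1 + c b\<close> is invertible, then \<open>x g = x\<close>, and the commutator of \<open>g\<close>
  with \<open>1 + x\<close> is \<open>1 + c b x\<close>. The coefficients \<open>b c a\<close> obtained in this way add up to
  everything, by simplicity.
\<close>

lemma root_in_K:
  fixes c d :: 'a
  assumes "null_pair c d"
  shows "1 + c * a * d \<in> K"
proof -
  have dc: "d * c = 0" and c0: "c \<noteq> 0" using assms by (auto simp: null_pair_def)
  then have dcx: "d * (c * z) = 0" for z by (simp flip: mult.assoc)
  have small: "1 + c * (b * c * a) * d \<in> K" if b: "norm (c * b) < 1" for a b
  proof -
    define x where "x = c * a * d"
    define g where "g = 1 + c * b"
    have x2: "x * x = 0" by (simp add: x_def mult.assoc dcx)
    have g: "g \<in> G" unfolding g_def by (rule near_one_in_G[OF b])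
    have "x * g = x" by (simp add: x_def g_def distrib_left mult.assoc dcx dc)
    then have xg: "x * iv g = x" using iv_cancel[OF g] by (metis mult.assoc mult_1_right)
    have "g * (1 + x) * iv g * iv (1 + x) = (g * iv g + g * (x * iv g)) * (1 - x)"
      by (simp add: iv_square_zero[OF x2] distrib_left distrib_right mult.assoc)
    also have "\<dots> = (1 + g * x) * (1 - x)" using iv_right[OF g] xg by simp
    also have "\<dots> = 1 + c * b * x"
      using x2 by (simp add: g_def algebra_simps)
    finally have "1 + c * b * x \<in> K"
      using commutator_in_K[OF g square_zero_in_G[OF x2]] by simp
    then show ?thesis by (simp add: x_def mult.assoc)
  qed
  have "1 + c * y * d \<in> K" for y
  proof (rule full_induct[OF c0, where P = "\<lambda>y. 1 + c * y * d \<in> K"])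
    fix b a
    obtain t where t: "t > 0" "norm (t *\<^sub>R (c * b)) < 1" using small_scale[of 1] by auto
    then show "1 + c * (b * c * a) * d \<in> K" using small[of "t *\<^sub>R b" "(1 / t) *\<^sub>R a"] by simp
  next
    fix x y assume "1 + c * x * d \<in> K" "1 + c * y * d \<in> K"
    from sub_mult[OF K_subgroup this] show "1 + c * (x + y) * d \<in> K"
      by (simp add: algebra_simps dcx)
  qed
  then show ?thesis by blast
qed

text \<open>
  Let \<open>V\<close> be the root group of the null pair. Modulo \<open>H\<close> the elements of \<open>V\<close> and their
  conjugates by \<open>h\<close> agree, since \<open>H\<close> contains the commutators of \<open>h\<close> with elements of \<open>K\<close>. The
  Whitehead element \<open>D = (1 + w y) (1 + y w)\<^sup>-\<^sup>1\<close> is a product of elements of \<open>V\<close> and of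
  conjugates, so modulo \<open>H\<close> it lies in \<open>V\<close> and commutes with \<open>1 + v\<close>. On the other hand
  \<open>D\<close> acts on \<open>V\<close> as a diagonal matrix would: it turns \<open>v\<close> into \<open>(1 + w y) v (1 + y w)\<close>.
  The commutator of \<open>D\<close> with \<open>1 + v\<close> is the asserted element of \<open>H\<close>.
\<close>

lemma whitehead_commutator:
  fixes c d :: 'a
  assumes H: "commutator_normalized H" and cd: "null_pair c d" and h: "h \<in> H"
    and wdef: "w = c * b * d" and vdef: "v = c * b' * d" and udef: "u = c * e * d"
    and ydef: "y = h * u * iv h" and small: "norm (w * y) < 1"
  shows "1 + (w * y * v + v * y * w + w * y * v * y * w) \<in> H"
proof -
  have Hs: "subgroup H GA" using H unfolding commutator_normalized_def by blast
  have hG: "h \<in> G" using sub_G[OF Hs h] .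
  have dc: "d * c = 0" using cd by (auto simp: null_pair_def)
  then have dcx: "d * (c * z) = 0" for z by (simp flip: mult.assoc)
  define r where "r = iv (1 + w * y)"
  have gG: "1 + w * y \<in> G" by (rule near_one_in_G[OF small])
  have r1: "r = 1 - r * w * y" using iv_left[OF gG] by (simp add: r_def algebra_simps)
  have r2: "r = 1 - w * y * r" using iv_right[OF gG] by (simp add: r_def algebra_simps)
  have ww: "w * w = 0" "w * v = 0" "v * w = 0" "v * v = 0" "u * u = 0" "u * w = 0" "w * u = 0"
      "u * v = 0" "v * u = 0"
    by (simp_all add: wdef vdef udef mult.assoc dcx)
  have yy: "y * y = 0"
  proof -
    have "y * y = h * (u * (iv h * h) * u) * iv h" by (simp add: ydef mult.assoc)
    then show ?thesis using ww iv_left[OF hG] by simp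
  qed
  have wwx: "w * (w * x) = 0" and yyx: "y * (y * x) = 0" for x
    using ww yy by (simp_all flip: mult.assoc)
  have ry: "r * y = y"
  proof -
    have "r * y = y - r * w * (y * y)" by (subst r1) (simp add: left_diff_distrib mult.assoc)
    then show ?thesis using yy by simp
  qed
  have wr: "w * r = w"
  proof -
    have "w * r = w - (w * w) * y * r" by (subst r2) (simp add: right_diff_distrib mult.assoc)
    then show ?thesis using ww by simp
  qed
  \<comment> \<open>The outer factors of \<open>D\<close> will be \<open>1 - h * u' * iv h\<close> and \<open>1 - w'\<close>.\<close>
  define u' where "u' = c * (e - e * d * (iv h * r * w * h) * c * e) * d"
  define w' where "w' = c * (b - b * d * y * r * c * b) * d"
  have yr: "y * r = h * u' * iv h"
  proof -
    have "y * r = y - y * r * w * y" by (subst r1) (simp add: right_diff_distrib mult.assoc)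
    also have "\<dots> = h * u' * iv h"
      by (simp add: ydef udef u'_def algebra_simps)
    finally show ?thesis .
  qed
  have rw: "r * w = w'"
  proof -
    have "r * w = w - w * y * r * w" by (subst r2) (simp add: left_diff_distrib mult.assoc)
    also have "\<dots> = w'" by (simp add: wdef w'_def algebra_simps)
    finally show ?thesis .
  qed
  have z': "u' * u' = 0" "w' * w' = 0" "w' * v = 0" "v * w' = 0" "u' * v = 0" "v * u' = 0"
    by (simp_all add: u'_def w'_def vdef mult.assoc dcx)
  have inK: "1 + w \<in> K" "1 + u \<in> K" "1 + v \<in> K" "1 + - u' \<in> K" "1 + - w' \<in> K"
    using root_in_K[OF cd, of b] root_in_K[OF cd, of e] root_in_K[OF cd, of b']
      root_in_K[OF cd, of "- (e - e * d * (iv h * r * w * h) * c * e)"]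
      root_in_K[OF cd, of "- (b - b * d * y * r * c * b)"]
    unfolding wdef udef vdef u'_def w'_def mult_minus_left mult_minus_right by blast+
  have k1: "(1 + y) * (1 - u) \<in> H"
  proof -
    have "h * (1 + u) * iv h * iv (1 + u) = (1 + y) * (1 - u)"
      using iv_right[OF hG] by (simp add: iv_square_zero ww ydef distrib_left distrib_right)
    then show ?thesis using commutator_normalized_commutator[OF H h inK(2)] by simp
  qed
  have k2: "(1 - y * r) * (1 + u') \<in> H"
  proof -
    have "h * (1 + - u') * iv h * iv (1 + - u') = (1 - y * r) * (1 + u')"
      using iv_right[OF hG] iv_square_zero[of "- u'"] z'
      by (simp add: yr distrib_left distrib_right left_diff_distrib right_diff_distrib)
    then show ?thesis using commutator_normalized_commutator[OF H h inK(4)] by simp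
  qed
  \<comment> \<open>This is the Whitehead element because \<open>1 - y * r * w\<close> inverts \<open>1 + y * w\<close> and \<open>y * y = 0\<close>.\<close>
  define D where "D = 1 + w * y - y * r * w"
  \<comment> \<open>\<open>D\<close> is a product of \<open>n\<close> in \<open>H\<close> and of a root element \<open>s\<close>.\<close>
  define p where "p = (1 + - u') * (1 + w)"
  define s where "s = p * (1 + u) * (1 + - w')"
  define n where "n = (1 - y * r) * (1 + u') * (p * ((1 + y) * (1 - u)) * iv p)"
  have pK: "p \<in> K" unfolding p_def by (intro sub_mult[OF K_subgroup] inK)
  have sK: "s \<in> K" unfolding s_def by (intro sub_mult[OF K_subgroup] inK pK)
  have pG: "p \<in> G" and sG: "s \<in> G" using pK sK K_G by auto
  have nH: "n \<in> H" unfolding n_def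
    using k1 k2 pK H unfolding commutator_normalized_def by (intro sub_mult[OF Hs k2]) blast
  then have nG: "n \<in> G" by (rule sub_G[OF Hs])
  have Dns: "D = n * s"
  proof -
    have "n * s = (1 - y * r) * ((1 + u') * (1 - u')) * (1 + w) * (1 + y) * ((1 - u) * (1 + u)) * (1 + - w')"
      unfolding n_def s_def by (simp add: mult.assoc iv_cancel[OF pG]) (simp add: p_def mult.assoc)
    also have "\<dots> = (1 - y * r) * (1 + w) * (1 + y) * (1 - r * w)"
      using z' ww by (simp add: algebra_simps rw)
    also have "(1 - y * r) * (1 + w) * (1 + y) = 1 + w + (y - y * (r + r * w * y)) + w * y - y * r * w - y * (r * y)"
      by (simp add: algebra_simps)
    also have "r + r * w * y = 1" using r1 by (metis diff_add_cancel)
    also have "r * y = y" by (rule ry)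
    also have "(1 + w + (y - y * 1) + w * y - y * r * w - y * y) * (1 - r * w)
        = 1 + w + w * y - y * r * w - (r + w * y * r) * w - w * r * w + y * r * (w * r) * w"
      by (simp add: algebra_simps yy)
    also have "r + w * y * r = 1" using r2 by (metis diff_add_cancel)
    also have "w * r = w" by (rule wr)
    also have "1 + w + w * y - y * r * w - 1 * w - w * w + y * r * w * w = D"
      by (simp add: D_def mult.assoc ww)
    finally show ?thesis by simp
  qed
  have DG: "D \<in> G" unfolding Dns by (rule G_mult[OF nG sG])
  define z where "z = (1 + w * y) * v * (1 + y * w)"
  have Dv: "D * (1 + v) = (1 + z) * D"
  proof -
    have "D * v = (1 + w * y) * v"
      by (simp add: D_def algebra_simps ww)
    also have "\<dots> = z * D"
    proof -
      have vwx: "v * (w * x) = 0" for x using ww by (simp flip: mult.assoc)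
      have "v * y * ((r + w * y * r) * w) = v * y * w"
        using r2 by (metis diff_add_cancel mult_1_left)
      then have "v * (1 + y * w) * D = v"
        by (simp add: D_def algebra_simps ww yy wwx yyx vwx)
      then show ?thesis by (simp add: z_def mult.assoc)
    qed
    finally show ?thesis by (simp add: distrib_left distrib_right)
  qed
  have "D * (1 + v) * iv D * iv (1 + v) = (1 + z) * (1 - v)"
    unfolding Dv by (simp add: mult.assoc iv_cancel[OF DG] iv_square_zero ww)
  also have "\<dots> = 1 + (w * y * v + v * y * w + w * y * v * y * w)"
    by (simp add: z_def algebra_simps ww)
  finally have lhs: "D * (1 + v) * iv D * iv (1 + v) = \<dots>" .
  have sv: "s * (1 + v) = (1 + v) * s"
  proof -
    have "v * (u * x) = 0" "v * (w * x) = 0" "v * (u' * x) = 0" for x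
      using ww z' by (simp_all flip: mult.assoc)
    then show ?thesis unfolding s_def p_def by (simp add: algebra_simps ww z')
  qed
  have "D * (1 + v) * iv D * iv (1 + v) = n * (s * (1 + v)) * iv s * iv n * iv (1 + v)"
    unfolding Dns by (simp add: iv_mult[OF nG sG] mult.assoc)
  also have "\<dots> = n * (1 + v) * iv n * iv (1 + v)"
    unfolding sv by (simp add: mult.assoc iv_cancel[OF sG])
  also have "\<dots> \<in> H" by (rule commutator_normalized_commutator[OF H nH inK(3)])
  finally show ?thesis unfolding lhs .
qed

text \<open>
  By the preceding lemma the additive group of all \<open>a\<close> with \<open>1 + c a d\<close> in \<open>H\<close> contains
  elements \<open>t L + t\<^sup>2 M\<close> for all small real \<open>t\<close> of either sign, where \<open>L\<close> is a generator as in
  \<open>jordan_span_full\<close> for \<open>P = d h c\<close> and \<open>Q = d h\<^sup>-\<^sup>1 c\<close>. Subtracting the elements for \<open>t\<close>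
  and \<open>- t\<close> isolates \<open>L\<close>.
\<close>

lemma root_transfer:
  fixes c d :: 'a
  assumes H: "commutator_normalized H" and cd: "null_pair c d" and h: "h \<in> H"
    and P: "d * h * c \<noteq> 0" and Q: "d * iv h * c \<noteq> 0"
  shows "1 + c * a * d \<in> H"
proof -
  have Hs: "subgroup H GA" using H unfolding commutator_normalized_def by blast
  have dc: "d * c = 0" using cd by (auto simp: null_pair_def)
  then have dcx: "d * (c * z) = 0" for z by (simp flip: mult.assoc)
  define J where "J = {a. 1 + c * a * d \<in> H}"
  have J0: "0 \<in> J" using sub_one[OF Hs] by (simp add: J_def)
  have Jdiff: "x - y \<in> J" if "x \<in> J" "y \<in> J" for x y
  proof -
    have "iv (1 + c * y * d) = 1 - c * y * d" by (rule iv_square_zero) (simp add: mult.assoc dcx)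
    moreover have "(1 + c * x * d) * iv (1 + c * y * d) \<in> H"
      using that by (intro sub_mult[OF Hs] sub_iv[OF Hs]) (auto simp: J_def)
    ultimately have "(1 + c * x * d) * (1 - c * y * d) \<in> H" by (simp only:)
    moreover have "(1 + c * x * d) * (1 - c * y * d) = 1 + c * (x - y) * d"
      by (simp add: algebra_simps dcx)
    ultimately show ?thesis by (simp add: J_def)
  qed
  have "b * (d * h * c) * e * (d * iv h * c) * b' + b' * (d * h * c) * e * (d * iv h * c) * b \<in> J"
    for b e b'
  proof -
    define y where "y = h * (c * e * d) * iv h"
    obtain t where t: "t > 0" "norm (t *\<^sub>R (c * b * d * y)) < 1" using small_scale[of 1] by auto
    define L where "L b' = b * (d * h * c) * e * (d * iv h * c) * b' + b' * (d * h * c) * e * (d * iv h * c) * b" for b'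
    define M where "M b' = b * (d * y * c) * b' * (d * y * c) * b" for b'
    have L: "L b' = b * (d * y * c) * b' + b' * (d * y * c) * b" for b'
      by (simp add: L_def y_def mult.assoc)
    have mem: "s *\<^sub>R L b' + (s * s) *\<^sub>R M b' \<in> J" if s: "norm (s *\<^sub>R (c * b * d * y)) < 1" for s b'
    proof -
      let ?w = "c * (s *\<^sub>R b) * d" and ?v = "c * b' * d"
      have "norm (?w * y) < 1" using s by simp
      from whitehead_commutator[OF H cd h refl refl refl y_def this, of b']
      have "1 + (?w * y * ?v + ?v * y * ?w + ?w * y * ?v * y * ?w) \<in> H" .
      moreover have "?w * y * ?v + ?v * y * ?w + ?w * y * ?v * y * ?w
          = c * (s *\<^sub>R L b' + (s * s) *\<^sub>R M b') * d"
        by (simp only: L M_def distrib_left distrib_right mult_scaleR_left mult_scaleR_right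
            scaleR_add_right scaleR_scaleR mult.assoc)
      ultimately show ?thesis unfolding J_def by simp
    qed
    have "(t *\<^sub>R L b' + (t * t) *\<^sub>R M b') - ((- t) *\<^sub>R L b' + (- t * - t) *\<^sub>R M b') \<in> J" for b'
      using t(2) by (intro Jdiff mem) (simp_all only: scaleR_minus_left norm_minus_cancel)
    moreover have "(t *\<^sub>R L b' + (t * t) *\<^sub>R M b') - ((- t) *\<^sub>R L b' + (- t * - t) *\<^sub>R M b')
        = (2 * t) *\<^sub>R L b'" for b'
      by (simp add: scaleR_2 flip: scaleR_scaleR)
    ultimately have "(2 * t) *\<^sub>R L ((1 / (2 * t)) *\<^sub>R b') \<in> J" by (simp only:)
    moreover have "(2 * t) *\<^sub>R L ((1 / (2 * t)) *\<^sub>R b') = L b'"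
      using t(1) by (simp add: L_def scaleR_add_right)
    ultimately have "L b' \<in> J" by (simp only:)
    then show ?thesis unfolding L_def .
  qed
  from jordan_span_full[OF P Q J0 Jdiff this] have "a \<in> J" .
  then show ?thesis by (simp add: J_def)
qed

end

section \<open>Noncentral subgroups contain all root elements\<close>

text \<open>
  The inverse of \<open>1 - t a\<close> tends to \<open>1\<close> as \<open>t\<close> tends to \<open>0\<close>.
\<close>

lemma resolvent_nonzero:
  fixes X Y a :: "'a::unital_cstar_algebra"
  assumes "X * Y \<noteq> 0"
  obtains t where "t > 0" "1 - t *\<^sub>R a \<in> G" "X * iv (1 - t *\<^sub>R a) * Y \<noteq> 0"
proof -
  define \<epsilon> where "\<epsilon> = norm (X * Y) / (2 * (norm X * norm Y) + 1)"
  have pos: "2 * (norm X * norm Y) + 1 > 0" by (simp add: add_nonneg_pos)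
  have "\<epsilon> > 0" unfolding \<epsilon>_def using assms pos by simp
  then obtain t where t: "t > 0" "norm (t *\<^sub>R a) < min (1/2) \<epsilon>" using small_scale[of "min (1/2) \<epsilon>" a] by auto
  define g where "g = neumann (t *\<^sub>R a)"
  have G: "1 - t *\<^sub>R a \<in> G" using near_one_in_G[of "- (t *\<^sub>R a)"] t by simp
  have g: "iv (1 - t *\<^sub>R a) = g" "(1 - t *\<^sub>R a) * g = 1"
    using t neumann_left[of "t *\<^sub>R a"] neumann_right[of "t *\<^sub>R a"] by (auto intro!: iv_eqI[OF G] simp: g_def)
  have ng: "norm g \<le> 2" using t neumann_norm[of "t *\<^sub>R a"] by (simp add: g_def)
  have "X * g * Y \<noteq> 0"
  proof
    assume 0: "X * g * Y = 0"
    have "g = 1 + t *\<^sub>R a * g" using g(2) by (simp add: algebra_simps)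
    from arg_cong[OF this, of "\<lambda>x. X * x * Y"]
    have "X * g * Y = X * Y + X * (t *\<^sub>R a) * g * Y"
      by (simp add: distrib_left distrib_right mult.assoc)
    then have "norm (X * Y) = norm (X * (t *\<^sub>R a) * g * Y)"
      using 0 by (metis add_eq_0_iff norm_minus_cancel)
    also have "\<dots> \<le> norm (X * (t *\<^sub>R a)) * norm g * norm Y"
      by (meson norm_mult_ineq mult_right_mono norm_ge_zero order_trans)
    also have "\<dots> \<le> (norm X * \<epsilon>) * 2 * norm Y"
    proof (intro mult_mono mult_nonneg_nonneg)
      show "norm (X * (t *\<^sub>R a)) \<le> norm X * \<epsilon>"
        by (rule order_trans[OF norm_mult_ineq mult_left_mono]) (use t(2) in auto)
    qed (use ng \<open>\<epsilon> > 0\<close> in auto)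
    also have "\<dots> = (2 * (norm X * norm Y)) * \<epsilon>" by simp
    also have "\<dots> < (2 * (norm X * norm Y) + 1) * \<epsilon>" using \<open>\<epsilon> > 0\<close> by simp
    also have "\<dots> = norm (X * Y)" using pos by (simp add: \<epsilon>_def)
    finally show False by simp
  qed
  then show ?thesis using that t G g by auto
qed

context simple_cstar
begin

text \<open>
  The elements \<open>a\<close> with \<open>d a c = 0\<close> form a proper subgroup, and every element is a difference
  of two elements outside of it.
\<close>

lemma generic_induct:
  fixes c d x :: 'a
  assumes "c \<noteq> 0" "d \<noteq> 0"
    and gen: "\<And>a. d * a * c \<noteq> 0 \<Longrightarrow> P a"
    and diff: "\<And>x y. P x \<Longrightarrow> P y \<Longrightarrow> P (x - y)"
  shows "P x"
proof (cases "d * x * c = 0")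
  case True
  obtain a where a: "d * a * c \<noteq> 0" using prime assms(1,2) by metis
  then have "d * (x + a) * c \<noteq> 0" using True by (simp add: distrib_left distrib_right)
  from diff[OF gen[OF this] gen[OF a]] show ?thesis by simp
qed (rule gen)

text \<open>
  Conjugating the null pair by \<open>g\<close> with \<open>d g c \<noteq> 0\<close> gives square zero elements that show
  \<open>d g\<^sup>-\<^sup>1 \<in> L\<close>. For \<open>g\<^sup>-\<^sup>1 = 1 - t a\<close> with small \<open>t\<close> this means \<open>d a \<in> L\<close>, for generic
  and hence for all \<open>a\<close>.
\<close>

lemma left_ideal_full:
  fixes c d x :: 'a
  assumes cd: "null_pair c d"
    and add: "\<And>x y. x \<in> L \<Longrightarrow> y \<in> L \<Longrightarrow> x + y \<in> L"
    and left: "\<And>a x. x \<in> L \<Longrightarrow> a * x \<in> L"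
    and dL: "d \<in> L"
    and dn: "\<And>c' d' a. null_pair c' d' \<Longrightarrow> d * (c' * a * d') \<in> L"
  shows "x \<in> L"
proof -
  have c0: "c \<noteq> 0" and d0: "d \<noteq> 0" and dc: "d * c = 0" using cd by (auto simp: null_pair_def)
  have diff: "x - y \<in> L" if "x \<in> L" "y \<in> L" for x y
    using add[OF that(1) left[OF that(2), of "- 1"]] by simp
  have conj: "d * iv g \<in> L" if g: "g \<in> G" and nz: "d * g * c \<noteq> 0" for g
  proof -
    have "z * (d * iv g) \<in> L" for z
    proof (rule full_induct[OF nz, where P = "\<lambda>z. z * (d * iv g) \<in> L"])
      fix y a
      show "y * (d * g * c) * a * (d * iv g) \<in> L"
        using left[OF dn[OF null_pair_conj[OF cd g], of a], of y] by (simp add: mult.assoc)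
    next
      fix y z assume "y * (d * iv g) \<in> L" "z * (d * iv g) \<in> L"
      from add[OF this] show "(y + z) * (d * iv g) \<in> L" by (simp add: distrib_right)
    qed
    from this[of 1] show ?thesis by simp
  qed
  have dA: "d * a \<in> L" for a
  proof (rule generic_induct[OF c0 d0, where P = "\<lambda>a. d * a \<in> L"])
    fix a assume nz: "d * a * c \<noteq> 0"
    obtain t where t: "t > 0" "1 - t *\<^sub>R a \<in> G" "d * a * iv (1 - t *\<^sub>R a) * c \<noteq> 0"
      using resolvent_nonzero[OF nz] by blast
    let ?g = "iv (1 - t *\<^sub>R a)"
    have "?g = 1 + t *\<^sub>R (a * ?g)" using iv_right[OF t(2)] by (simp add: algebra_simps)
    from arg_cong[OF this, of "\<lambda>x. d * x * c"] have "d * ?g * c = t *\<^sub>R (d * a * ?g * c)"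
      using dc by (simp add: distrib_left distrib_right mult.assoc)
    then have "d * ?g * c \<noteq> 0" using t by simp
    from conj[OF iv_closed[OF t(2)] this] have "d * (1 - t *\<^sub>R a) \<in> L" using iv_iv[OF t(2)] by simp
    from left[OF diff[OF dL this], of "(1 / t) *\<^sub>R 1"] show "d * a \<in> L"
      using t(1) by (simp add: algebra_simps)
  next
    fix x y assume "d * x \<in> L" "d * y \<in> L"
    from diff[OF this] show "d * (x - y) \<in> L" by (simp add: right_diff_distrib)
  qed
  show ?thesis
    by (rule full_induct[OF d0, where P = "\<lambda>x. x \<in> L"]) (use left[OF dA] add in \<open>auto simp: mult.assoc\<close>)
qed

text \<open>
  For each null pair the extended centroid yields a central eigenvalue: \<open>h c = l c\<close> and
  \<open>d h = l d\<close>. Comparing the pair with its conjugates by elements \<open>1 + t a\<close> shows that the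
  eigenvalue does not change, so that \<open>h\<close> acts as \<open>l\<close> on all of \<open>A c\<close>.
\<close>

lemma commutes_with_roots_central:
  fixes h :: 'a
  assumes ex: "null_pair c0 (d0::'a)"
    and comm: "\<And>c d a :: 'a. null_pair c d \<Longrightarrow> h * (c * a * d) = c * a * d * h"
  shows "h \<in> algebra_center"
proof -
  have ev: "\<exists>l\<in>algebra_center. h * c = l * c \<and> d * h = l * d" if cd: "null_pair c d" for c d
  proof -
    have "h * c * a * d = c * a * (d * h)" for a using comm[OF cd, of a] by (simp add: mult.assoc)
    from extended_centroid[OF this] cd show ?thesis unfolding null_pair_def by metis
  qed
  obtain l where l: "l \<in> algebra_center" "h * c0 = l * c0" "d0 * h = l * d0" using ev[OF ex] by blast
  have c0: "c0 \<noteq> 0" "d0 \<noteq> 0" "d0 * c0 = 0" using ex by (auto simp: null_pair_def)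
  have lc: "l * a = a * l" for a using l(1) unfolding algebra_center_def by blast
  have "(h - l) * a * c0 = 0" for a
  proof (rule generic_induct[OF c0(1,2), where P = "\<lambda>a. (h - l) * a * c0 = 0"])
    fix a assume nz: "d0 * a * c0 \<noteq> 0"
    obtain t where t: "t > 0" "norm (t *\<^sub>R a) < 1" using small_scale[of 1] by auto
    define g where "g = 1 + t *\<^sub>R a"
    have g: "g \<in> G" unfolding g_def by (rule near_one_in_G[OF t(2)])
    obtain m where m: "m \<in> algebra_center" "h * (g * c0) = m * (g * c0)"
      using ev[OF null_pair_conj[OF ex g]] by blast
    have mc: "m * a = a * m" for a using m(1) unfolding algebra_center_def by blast
    have dg: "d0 * g * c0 = t *\<^sub>R (d0 * a * c0)"
      by (simp add: g_def distrib_left distrib_right c0(3))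
    have "l * (d0 * g * c0) = d0 * (h * (g * c0))" by (metis l(3) mult.assoc)
    also have "\<dots> = m * (d0 * g * c0)" unfolding m(2) by (metis mc mult.assoc)
    finally have "(l - m) * (d0 * a * c0) = 0" using t(1) by (simp add: dg left_diff_distrib)
    moreover have "l - m \<in> algebra_center" using lc mc by (simp add: algebra_center_def left_diff_distrib right_diff_distrib)
    ultimately have "l = m" using central_mult_eq_0 nz by fastforce
    then have "(h - l) * (g * c0) = 0" using m(2) by (simp add: left_diff_distrib)
    then have "(h - l) * c0 + t *\<^sub>R ((h - l) * a * c0) = 0"
      by (simp add: g_def distrib_left distrib_right mult.assoc)
    then show "(h - l) * a * c0 = 0" using t(1) l(2) by (simp add: left_diff_distrib)
  qed (simp add: right_diff_distrib left_diff_distrib)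
  then have "h - l = 0" using primeD c0(1) by blast
  then show ?thesis using l(1) by simp
qed

text \<open>
  Suppose that \<open>d n c = 0\<close> for all null pairs. Conjugating a pair by \<open>1 - t a\<close> and letting \<open>t\<close>
  tend to \<open>0\<close> gives \<open>d a n c = d n a c\<close>. If \<open>d n \<noteq> 0\<close>, then \<open>(c, d n)\<close> is again a null pair,
  and \<open>n\<^sup>2 = 0\<close> leads to \<open>n c = 0\<close>. In every case \<open>n c = 0\<close>, for all conjugates of \<open>c\<close> too, which
  forces \<open>n = 0\<close>.
\<close>

lemma square_zero_detected:
  fixes n :: 'a
  assumes ex: "null_pair c0 (d0::'a)" and n: "n * n = 0" "n \<noteq> 0"
  obtains c d :: 'a where "null_pair c d" "d * n * c \<noteq> 0"
proof (rule ccontr)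
  assume "\<not> thesis"
  with that have z: "d * n * c = 0" if "null_pair c d" for c d using that by blast
  have swap: "d * a * n * c = d * n * a * c" if cd: "null_pair c d" for a c d
  proof (rule ccontr)
    assume "d * a * n * c \<noteq> d * n * a * c"
    then have "d * ((a * n - n * a) * c) \<noteq> 0" by (simp add: algebra_simps)
    then obtain t where t: "t > 0" "1 - t *\<^sub>R a \<in> G" "d * iv (1 - t *\<^sub>R a) * ((a * n - n * a) * c) \<noteq> 0"
      using resolvent_nonzero by metis
    let ?g = "iv (1 - t *\<^sub>R a)"
    have "?g = 1 + ?g * (t *\<^sub>R a)" using iv_left[OF t(2)] by (simp add: algebra_simps)
    from arg_cong[OF this, of "\<lambda>x. d * x * n * c"]
    have 1: "d * ?g * n * c = t *\<^sub>R (d * ?g * a * n * c)"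
      using z[OF cd] by (simp add: distrib_left distrib_right mult.assoc)
    have "d * ?g * n * ((1 - t *\<^sub>R a) * c) = 0"
      using z[OF null_pair_conj[OF cd t(2)]] .
    then have 2: "d * ?g * n * c = t *\<^sub>R (d * ?g * n * a * c)" by (simp add: algebra_simps)
    have "t *\<^sub>R (d * ?g * ((a * n - n * a) * c)) = 0"
      using 1 2 by (simp add: algebra_simps)
    then show False using t by simp
  qed
  have nc: "n * c = 0" if cd: "null_pair c d" for c d
  proof (rule ccontr)
    assume nc: "n * c \<noteq> 0"
    have nz: "c \<noteq> 0" "d \<noteq> 0" using cd by (auto simp: null_pair_def)
    have "d * n = 0"
    proof (rule ccontr)
      assume dn: "d * n \<noteq> 0"
      then have "null_pair c (d * n)" using nz z[OF cd] by (simp add: null_pair_def)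
      from swap[OF this] have "d * n * a * (n * c) = 0" for a using n(1) by (simp add: mult.assoc flip: mult.assoc[of n n])
      then show False using primeD[of "d * n" "n * c"] dn nc by blast
    qed
    then have "d * a * (n * c) = 0" for a using swap[OF cd, of a] by (simp add: mult.assoc)
    then show False using primeD[of d "n * c"] nz nc by blast
  qed
  have "n * a * c0 = 0" for a
  proof -
    obtain t where t: "t > 0" "norm (t *\<^sub>R a) < 1" using small_scale[of 1] by auto
    have "n * ((1 + t *\<^sub>R a) * c0) = 0" by (rule nc[OF null_pair_conj[OF ex near_one_in_G[OF t(2)]]])
    then show ?thesis using nc[OF ex] t(1) by (simp add: distrib_left distrib_right mult.assoc)
  qed
  then show False using primeD[of n c0] n(2) ex by (auto simp: null_pair_def)
qed

text \<open>
  Take a null pair for which \<open>h\<close> does not commute with some \<open>c a d\<close>. If \<open>d h c\<close> or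
  \<open>d h\<^sup>-\<^sup>1 c\<close> vanishes, then commutators of \<open>h\<close> with root elements, or commutators of these,
  collapse to elements \<open>1 + n\<close> of \<open>H\<close> with \<open>n\<^sup>2 = 0\<close> and \<open>n \<noteq> 0\<close>. For such an element both
  products are \<open>d n c\<close> up to sign, and some null pair makes it nonzero.
\<close>

lemma exists_transferring_element:
  fixes H :: "'a set"
  assumes H: "commutator_normalized H" and h: "h \<in> H" "h \<notin> algebra_center"
  obtains c d h' where "null_pair c d" "h' \<in> H" "d * h' * c \<noteq> 0" "d * iv h' * c \<noteq> 0"
proof -
  note result = that
  have Hs: "subgroup H GA" using H unfolding commutator_normalized_def by blast
  have hG: "h \<in> G" using sub_G[OF Hs] h by blast
  obtain a where "h * a \<noteq> a * h" using h(2) unfolding algebra_center_def by blast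
  then obtain c0 d0 :: 'a where ex: "null_pair c0 d0"
    using noncommutative_imp_zero_divisors unfolding null_pair_def by metis
  have square_zero_suffices: thesis if n: "n * n = 0" "n \<noteq> 0" "1 + n \<in> H" for n
  proof -
    obtain c d where cd: "null_pair c d" "d * n * c \<noteq> 0" using square_zero_detected[OF ex n(1,2)] by blast
    then show thesis
      using result[OF cd(1) n(3)] iv_square_zero[OF n(1)]
      by (simp add: null_pair_def distrib_left distrib_right right_diff_distrib left_diff_distrib)
  qed
  have one_sided: thesis if cd: "null_pair c d" and h: "h \<in> H" and P: "d * h * c = 0" and Q: "d * iv h * c \<noteq> 0" for c d h
  proof -
    have hG: "h \<in> G" using sub_G[OF Hs] h by blast
    have c0: "c \<noteq> 0" "d \<noteq> 0" "d * c = 0" using cd by (auto simp: null_pair_def)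
    have dcx: "d * (c * z) = 0" "d * (h * (c * z)) = 0" for z using c0(3) P by (simp_all flip: mult.assoc)
    obtain e where e: "c * e * (d * iv h * c) \<noteq> 0" using prime[OF c0(1) Q] by blast
    obtain b where b: "c * e * (d * iv h * c) * b * d \<noteq> 0" using prime[OF e c0(2)] by blast
    define u where "u = c * e * d"
    define w where "w = c * b * d"
    define y where "y = h * u * iv h"
    have sq: "u * u = 0" "u * w = 0" "w * u = 0" "w * w = 0" "y * y = 0" "w * y = 0"
      by (simp_all add: u_def w_def y_def mult.assoc dcx iv_cancel[OF hG])
    have inK: "1 + u \<in> K" "1 + w \<in> K" unfolding u_def w_def by (intro root_in_K[OF cd])+
    have "h * (1 + u) * iv h * iv (1 + u) = (1 + y) * (1 - u)"
      using iv_right[OF hG] by (simp add: iv_square_zero sq y_def distrib_left distrib_right)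
    then have k: "(1 + y) * (1 - u) \<in> H" using commutator_normalized_commutator[OF H h inK(1)] by simp
    have ivk: "iv ((1 + y) * (1 - u)) = (1 + u) * (1 - y)"
    proof (rule iv_eqI[OF sub_G[OF Hs k]])
      have "(1 - y) * (1 + y) = 1" "(1 + u) * (1 - u) = 1" by (simp_all add: algebra_simps sq)
      then show "(1 + u) * (1 - y) * ((1 + y) * (1 - u)) = 1" by (metis mult.assoc mult_1_left)
    qed
    have "(1 + y) * (1 - u) * (1 + w) * iv ((1 + y) * (1 - u)) * iv (1 + w)
        = (1 + y) * ((1 - u) * (1 + w) * (1 + u)) * (1 - y) * (1 - w)"
      by (simp add: ivk iv_square_zero sq mult.assoc)
    also have "(1 - u) * (1 + w) * (1 + u) = 1 + w" by (simp add: algebra_simps sq)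
    also have "(1 + y) * (1 + w) * (1 - y) * (1 - w) = 1 + y * w"
      by (simp add: algebra_simps sq)
    finally have "1 + y * w \<in> H" using commutator_normalized_commutator[OF H k inK(2)] by simp
    moreover have "(y * w) * (y * w) = 0" by (simp add: mult.assoc) (simp add: sq flip: mult.assoc[of w y])
    moreover have "y * w \<noteq> 0"
    proof
      assume "y * w = 0"
      then have "iv h * (y * w) = 0" by simp
      then show False using b by (simp add: y_def u_def w_def mult.assoc iv_cancel[OF hG])
    qed
    ultimately show thesis using square_zero_suffices by blast
  qed
  obtain c d a0 where cd: "null_pair c d" and nc: "h * (c * a0 * d) \<noteq> c * a0 * d * h"
    using commutes_with_roots_central[OF ex, of h] h(2) by blast
  show thesis
  proof (cases "d * h * c = 0")
    case P: True
    show thesis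
    proof (cases "d * iv h * c = 0")
      case Q: True
      define u where "u = c * a0 * d"
      define n where "n = h * u * iv h - u"
      have dcx: "d * (c * z) = 0" "d * (h * (c * z)) = 0" "d * (iv h * (c * z)) = 0" for z
        using cd P Q by (simp_all flip: mult.assoc add: null_pair_def)
      have uu: "u * u = 0" by (simp add: u_def mult.assoc dcx)
      have "n * n = 0" by (simp add: n_def u_def left_diff_distrib right_diff_distrib mult.assoc dcx iv_cancel[OF hG])
      moreover have "n \<noteq> 0"
      proof
        assume "n = 0"
        then have "h * u * iv h * h = u * h" by (simp add: n_def)
        then show False using nc by (simp add: u_def mult.assoc iv_cancel[OF hG])
      qed
      moreover have "1 + n \<in> H"
      proof -
        have "h * (1 + u) * iv h * iv (1 + u) = 1 + n - h * u * iv h * u"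
          using iv_right[OF hG] by (simp add: iv_square_zero uu n_def algebra_simps)
        also have "h * u * iv h * u = 0" by (simp add: u_def mult.assoc dcx)
        finally show ?thesis
          using commutator_normalized_commutator[OF H h(1) root_in_K[OF cd, of a0]] by (simp add: u_def)
      qed
      ultimately show thesis by (rule square_zero_suffices)
    next
      case False
      then show thesis using one_sided[OF cd h(1) P] by blast
    qed
  next
    case P: False
    show thesis
    proof (cases "d * iv h * c = 0")
      case True
      then show thesis using one_sided[OF cd sub_iv[OF Hs h(1)]] P iv_iv[OF hG] by simp
    next
      case False
      then show thesis using result[OF cd h(1) P] by blast
    qed
  qed
qed

text \<open>
  One null pair \<open>(c\<^sub>0, d\<^sub>0)\<close> whose root elements all lie in \<open>H\<close> exists by the preceding lemmas.
  To pass to a given pair \<open>(c, d)\<close> it suffices to conjugate by some \<open>k \<in> K\<close> such that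
  \<open>d k c\<^sub>0\<close> and \<open>d\<^sub>0 k\<^sup>-\<^sup>1 c\<close> are nonzero, since then the conjugate of a root element serves as
  \<open>h\<close> in \<open>root_transfer\<close>. The two conditions are achieved one after the other.
\<close>

proposition noncentral_contains_roots:
  fixes H :: "'a set"
  assumes H: "commutator_normalized H" and h: "h \<in> H" "h \<notin> algebra_center" and cd: "null_pair c d"
  shows "1 + c * a * d \<in> H"
proof -
  have Hs: "subgroup H GA" using H unfolding commutator_normalized_def by blast
  have Hconj: "k * x * iv k \<in> H" if "k \<in> K" "x \<in> H" for k x using H that unfolding commutator_normalized_def by blast
  obtain c0 d0 h' where cd0: "null_pair c0 d0" and h': "h' \<in> H" "d0 * h' * c0 \<noteq> 0" "d0 * iv h' * c0 \<noteq> 0"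
    using exists_transferring_element[OF H h] by blast
  have root0: "1 + c0 * x * d0 \<in> H" for x by (rule root_transfer[OF H cd0 h'])
  have move: "\<exists>n. d * n * c' \<noteq> 0 \<and> n * n = 0 \<and> 1 + n \<in> K \<and> 1 + - n \<in> K"
    if cd: "null_pair c d" and c': "c' \<noteq> 0" "d * c' = 0" for c d c' :: 'a
  proof (rule ccontr)
    assume none: "\<not> ?thesis"
    have kill: "d * (c1 * a * d1) * c' = 0" if cd1: "null_pair c1 d1" for c1 d1 a
    proof (rule ccontr)
      assume "d * (c1 * a * d1) * c' \<noteq> 0"
      moreover have "(c1 * a * d1) * (c1 * a * d1) = 0"
      proof -
        have "(c1 * a * d1) * (c1 * a * d1) = c1 * a * (d1 * c1) * a * d1" by (simp add: mult.assoc)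
        then show ?thesis using cd1 by (simp add: null_pair_def)
      qed
      moreover have "1 + c1 * a * d1 \<in> K" "1 + - (c1 * a * d1) \<in> K"
        using root_in_K[OF cd1, of a] root_in_K[OF cd1, of "- a"] by simp_all
      ultimately show False using none by blast
    qed
    have "1 \<in> {x. x * c' = 0}"
    proof (rule left_ideal_full[OF cd])
      show "a * x \<in> {x. x * c' = 0}" if "x \<in> {x. x * c' = 0}" for a x
        using that by (simp add: mult.assoc)
      show "d * (c1 * a * d1) \<in> {x. x * c' = 0}" if "null_pair c1 d1" for c1 d1 a
        using kill[OF that] by blast
    qed (use c'(2) in \<open>simp_all add: distrib_right\<close>)
    then show False using c' by simp
  qed
  have "\<exists>e\<in>K. d * (e * c0) \<noteq> 0"
  proof (cases "d * c0 = 0")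
    case True
    obtain n where "d * n * c0 \<noteq> 0" "1 + n \<in> K"
      using move[OF cd _ True] cd0 unfolding null_pair_def by blast
    then show ?thesis using True by (intro bexI[of _ "1 + n"]) (simp_all add: distrib_left distrib_right mult.assoc)
  next
    case False
    then show ?thesis using sub_one[OF K_subgroup] by (intro bexI[of _ 1]) simp_all
  qed
  then obtain e where e: "e \<in> K" "d * (e * c0) \<noteq> 0" by blast
  define c1 where "c1 = e * c0"
  define d1 where "d1 = d0 * iv e"
  have cd1: "null_pair c1 d1" unfolding c1_def d1_def by (rule null_pair_conj[OF cd0 K_G[OF e(1)]])
  have root1: "1 + c1 * x * d1 \<in> H" for x
    using Hconj[OF e(1) root0[of x]] iv_right[OF K_G[OF e(1)]]
    by (simp add: c1_def d1_def distrib_left distrib_right mult.assoc)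
  have dc1: "d * c1 \<noteq> 0" using e by (simp add: c1_def)
  have "\<exists>k\<in>K. d * k * c1 \<noteq> 0 \<and> d1 * iv k * c \<noteq> 0"
  proof (cases "d1 * c = 0")
    case True
    obtain n where n: "d1 * n * c \<noteq> 0" "n * n = 0" "1 + n \<in> K" "1 + - n \<in> K"
      using move[OF cd1 _ True] cd unfolding null_pair_def by blast
    have ivn: "iv (1 + n) = 1 - n" "iv (1 + - n) = 1 + n"
      using iv_square_zero[of n] iv_square_zero[of "- n"] n(2) by simp_all
    \<comment> \<open>The sum of the two products is \<open>2 d c\<^sub>1\<close>, so one of the signs keeps the first condition.\<close>
    have "d * (1 + n) * c1 \<noteq> 0 \<or> d * (1 + - n) * c1 \<noteq> 0"
    proof (rule ccontr)
      assume "\<not> ?thesis"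
      then have "d * (1 + n) * c1 + d * (1 + - n) * c1 = 0" by simp
      then have "2 *\<^sub>R (d * c1) = 0" by (simp add: algebra_simps scaleR_2)
      then show False using dc1 by simp
    qed
    moreover have "d1 * iv (1 + n) * c \<noteq> 0" "d1 * iv (1 + - n) * c \<noteq> 0"
      unfolding ivn using n(1) True by (simp_all add: distrib_left distrib_right right_diff_distrib left_diff_distrib)
    ultimately show ?thesis using n(3,4) by blast
  next
    case False
    have "iv 1 = (1::'a)" using GA.inv_one by simp
    then show ?thesis using False dc1 sub_one[OF K_subgroup] by (intro bexI[of _ 1]) simp_all
  qed
  then obtain k where k: "k \<in> K" "d * k * c1 \<noteq> 0" "d1 * iv k * c \<noteq> 0" by blast
  obtain x where x: "d * k * c1 * x * (d1 * iv k * c) \<noteq> 0" using prime[OF k(2,3)] by blast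
  define n where "n = k * c1 * x * d1 * iv k"
  have kG: "k \<in> G" using k(1) K_G by blast
  have nn: "n * n = 0"
  proof -
    have "n * n = k * c1 * x * (d1 * (iv k * k) * c1) * x * d1 * iv k" by (simp add: n_def mult.assoc)
    then show ?thesis using cd1 iv_left[OF kG] by (simp add: null_pair_def)
  qed
  have nH: "1 + n \<in> H" using Hconj[OF k(1) root1[of x]] iv_right[OF kG]
    by (simp add: n_def distrib_left distrib_right mult.assoc)
  have dn: "d * n * c \<noteq> 0" using x by (simp add: n_def mult.assoc)
  have "d * c = 0" using cd by (simp add: null_pair_def)
  then show ?thesis
    using dn by (intro root_transfer[OF H cd nH])
      (simp_all add: iv_square_zero[OF nn] distrib_left distrib_right right_diff_distrib left_diff_distrib)
qed

end

section \<open>Invertibles modulo root elements\<close>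

text \<open>
  Since \<open>1 + b (x + y) = (1 + b x) (1 + (1 + b x)\<^sup>-\<^sup>1 b y)\<close>, the elements \<open>x\<close> for which a
  subgroup contains all \<open>1 + b x\<close> with small \<open>b\<close> form a left ideal. This turns additive
  decompositions of \<open>1\<close> into multiplicative ones of the elements near \<open>1\<close>, without any inverse
  function theorem.
\<close>

lemma near_left_add:
  fixes S :: "'a::unital_cstar_algebra set"
  assumes S: "subgroup S GA"
    and x: "\<exists>\<delta>>0. \<forall>b. norm b < \<delta> \<longrightarrow> 1 + b * x \<in> S"
    and y: "\<exists>\<delta>>0. \<forall>b. norm b < \<delta> \<longrightarrow> 1 + b * y \<in> S"
  shows "\<exists>\<delta>>0. \<forall>b. norm b < \<delta> \<longrightarrow> 1 + b * (x + y) \<in> S"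
proof -
  obtain \<delta>1 where \<delta>1: "\<delta>1 > 0" "\<And>b. norm b < \<delta>1 \<Longrightarrow> 1 + b * x \<in> S" using x by blast
  obtain \<delta>2 where \<delta>2: "\<delta>2 > 0" "\<And>b. norm b < \<delta>2 \<Longrightarrow> 1 + b * y \<in> S" using y by blast
  have pos: "norm x + 1 > 0" using norm_ge_zero[of x] by linarith
  define \<delta> where "\<delta> = min \<delta>1 (min (\<delta>2 / 2) (1 / (2 * (norm x + 1))))"
  have "1 + b * (x + y) \<in> S" if b: "norm b < \<delta>" for b
  proof -
    have g: "1 + b * x \<in> S" using b by (intro \<delta>1) (simp add: \<delta>_def)
    have gG: "1 + b * x \<in> G" by (rule sub_G[OF S g])
    have "norm (b * x) \<le> norm b * (norm x + 1)"
      by (rule order_trans[OF norm_mult_ineq]) (simp add: mult_left_mono)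
    also have "\<dots> \<le> 1 / (2 * (norm x + 1)) * (norm x + 1)"
      using b pos by (intro mult_right_mono) (simp_all add: \<delta>_def)
    also have "\<dots> = 1/2" using pos by (simp add: field_simps)
    finally have small: "norm (- (b * x)) \<le> 1/2" by simp
    have "iv (1 + b * x) = neumann (- (b * x))"
      using neumann_left[of "- (b * x)"] small by (intro iv_eqI[OF gG]) simp
    then have "norm (iv (1 + b * x)) \<le> 2" using neumann_norm[OF small] by simp
    then have "norm (iv (1 + b * x) * b) \<le> 2 * norm b"
      by (intro order_trans[OF norm_mult_ineq] mult_right_mono) auto
    also have "\<dots> < \<delta>2" using b by (simp add: \<delta>_def)
    finally have "1 + iv (1 + b * x) * b * y \<in> S" by (rule \<delta>2)
    from sub_mult[OF S g this]
    have "1 + b * x + (1 + b * x) * iv (1 + b * x) * b * y \<in> S"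
      by (simp add: distrib_left mult.assoc)
    then show ?thesis by (simp add: iv_right[OF gG] distrib_left add.assoc)
  qed
  moreover have "\<delta> > 0" using \<delta>1 \<delta>2 pos by (simp add: \<delta>_def)
  ultimately show ?thesis by blast
qed

lemma near_left_mult:
  fixes S :: "'a::unital_cstar_algebra set"
  assumes "\<exists>\<delta>>0. \<forall>b. norm b < \<delta> \<longrightarrow> 1 + b * x \<in> S"
  shows "\<exists>\<delta>>0. \<forall>b. norm b < \<delta> \<longrightarrow> 1 + b * (a * x) \<in> S"
proof -
  obtain \<delta> where \<delta>: "\<delta> > 0" "\<And>b. norm b < \<delta> \<Longrightarrow> 1 + b * x \<in> S" using assms by blast
  have pos: "norm a + 1 > 0" using norm_ge_zero[of a] by linarith
  have "1 + b * (a * x) \<in> S" if b: "norm b < \<delta> / (norm a + 1)" for b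
  proof -
    have "norm (b * a) \<le> norm b * (norm a + 1)"
      by (rule order_trans[OF norm_mult_ineq]) (simp add: mult_left_mono)
    also have "\<dots> < \<delta>" using b pos by (simp add: field_simps)
    finally show ?thesis using \<delta>(2)[of "b * a"] by (simp add: mult.assoc)
  qed
  then show ?thesis using \<delta>(1) pos by (intro exI[of _ "\<delta> / (norm a + 1)"]) simp
qed

lemma near_right_add:
  fixes S :: "'a::unital_cstar_algebra set"
  assumes S: "subgroup S GA"
    and x: "\<exists>\<delta>>0. \<forall>b. norm b < \<delta> \<longrightarrow> 1 + x * b \<in> S"
    and y: "\<exists>\<delta>>0. \<forall>b. norm b < \<delta> \<longrightarrow> 1 + y * b \<in> S"
  shows "\<exists>\<delta>>0. \<forall>b. norm b < \<delta> \<longrightarrow> 1 + (y + x) * b \<in> S"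
proof -
  obtain \<delta>1 where \<delta>1: "\<delta>1 > 0" "\<And>b. norm b < \<delta>1 \<Longrightarrow> 1 + x * b \<in> S" using x by blast
  obtain \<delta>2 where \<delta>2: "\<delta>2 > 0" "\<And>b. norm b < \<delta>2 \<Longrightarrow> 1 + y * b \<in> S" using y by blast
  have pos: "norm x + 1 > 0" using norm_ge_zero[of x] by linarith
  define \<delta> where "\<delta> = min \<delta>1 (min (\<delta>2 / 2) (1 / (2 * (norm x + 1))))"
  have "1 + (y + x) * b \<in> S" if b: "norm b < \<delta>" for b
  proof -
    have g: "1 + x * b \<in> S" using b by (intro \<delta>1) (simp add: \<delta>_def)
    have gG: "1 + x * b \<in> G" by (rule sub_G[OF S g])
    have "norm (x * b) \<le> (norm x + 1) * norm b"
      by (rule order_trans[OF norm_mult_ineq]) (simp add: mult_right_mono)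
    also have "\<dots> \<le> (norm x + 1) * (1 / (2 * (norm x + 1)))"
      using b pos by (intro mult_left_mono) (simp_all add: \<delta>_def)
    also have "\<dots> = 1/2" using pos by (simp add: field_simps)
    finally have small: "norm (- (x * b)) \<le> 1/2" by simp
    have "iv (1 + x * b) = neumann (- (x * b))"
      using neumann_left[of "- (x * b)"] small by (intro iv_eqI[OF gG]) simp
    then have "norm (iv (1 + x * b)) \<le> 2" using neumann_norm[OF small] by simp
    then have "norm (b * iv (1 + x * b)) \<le> norm b * 2"
      by (intro order_trans[OF norm_mult_ineq] mult_left_mono) auto
    also have "\<dots> < \<delta>2" using b by (simp add: \<delta>_def)
    finally have "1 + y * (b * iv (1 + x * b)) \<in> S" by (rule \<delta>2)
    from sub_mult[OF S this g]
    have "1 + x * b + y * b * (iv (1 + x * b) * (1 + x * b)) \<in> S"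
      by (simp only: distrib_right mult_1_left mult.assoc)
    then show ?thesis by (simp only: iv_left[OF gG] mult_1_right distrib_right ac_simps)
  qed
  moreover have "\<delta> > 0" using \<delta>1 \<delta>2 pos by (simp add: \<delta>_def)
  ultimately show ?thesis by blast
qed

lemma near_right_mult:
  fixes S :: "'a::unital_cstar_algebra set"
  assumes "\<exists>\<delta>>0. \<forall>b. norm b < \<delta> \<longrightarrow> 1 + x * b \<in> S"
  shows "\<exists>\<delta>>0. \<forall>b. norm b < \<delta> \<longrightarrow> 1 + x * a * b \<in> S"
proof -
  obtain \<delta> where \<delta>: "\<delta> > 0" "\<And>b. norm b < \<delta> \<Longrightarrow> 1 + x * b \<in> S" using assms by blast
  have pos: "norm a + 1 > 0" using norm_ge_zero[of a] by linarith
  have "1 + x * a * b \<in> S" if b: "norm b < \<delta> / (norm a + 1)" for b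
  proof -
    have "norm (a * b) \<le> (norm a + 1) * norm b"
      by (rule order_trans[OF norm_mult_ineq]) (simp add: mult_right_mono)
    also have "\<dots> < \<delta>" using b pos by (simp add: field_simps)
    finally show ?thesis using \<delta>(2)[of "a * b"] by (simp add: mult.assoc)
  qed
  then show ?thesis using \<delta>(1) pos by (intro exI[of _ "\<delta> / (norm a + 1)"]) simp
qed

definition root_group :: "'a::unital_cstar_algebra set" where
  "root_group = generate GA {1 + c * a * d | c a d. null_pair c d}"

lemma null_pair_square: "null_pair c d \<Longrightarrow> (c * a * d) * (c * a * d) = 0"
proof -
  assume "null_pair c d"
  moreover have "(c * a * d) * (c * a * d) = c * a * (d * c) * a * d" by (simp add: mult.assoc)
  ultimately show ?thesis by (simp add: null_pair_def)
qed

lemma root_in_root_group: "null_pair c d \<Longrightarrow> 1 + c * a * d \<in> root_group"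
  unfolding root_group_def by (rule generate.incl) blast

lemma roots_in_G: "{1 + c * a * d | c a d. null_pair c d} \<subseteq> G"
  using square_zero_in_G[OF null_pair_square] by auto

lemma root_group_subgroup: "subgroup root_group GA"
  unfolding root_group_def by (rule GA.generate_is_subgroup[OF roots_in_G])

lemma root_group_conj:
  fixes x :: "'a::unital_cstar_algebra"
  assumes "x \<in> root_group" "g \<in> G" shows "g * x * iv g \<in> root_group"
proof -
  have "(root_group :: 'a set) \<lhd> GA"
    unfolding root_group_def
  proof (rule GA.normal_generateI[OF roots_in_G])
    fix h g :: 'a
    assume "h \<in> {1 + c * a * d | c a d. null_pair c d}" and g: "g \<in> G"
    then obtain c a d where h: "h = 1 + c * a * d" "null_pair c d" by blast
    have "g * h * iv g = 1 + (g * c) * a * (d * iv g)"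
      using iv_right[OF g] by (simp add: h(1) distrib_left distrib_right mult.assoc)
    then show "g \<otimes>\<^bsub>GA\<^esub> h \<otimes>\<^bsub>GA\<^esub> iv g \<in> {1 + c * a * d | c a d. null_pair c d}"
      using null_pair_conj[OF h(2) g] by auto
  qed
  from normal.inv_op_closed2[OF this] assms show ?thesis by simp
qed

lemma iv_one: "iv 1 = (1 :: 'a::unital_cstar_algebra)"
  by (rule iv_eqI[OF G_one]) simp

text \<open>
  Modulo the normal subgroup generated by root elements these sets are the centralizer of \<open>x\<close> and, below,
  the centre.
\<close>

lemma root_group_commutator_right:
  fixes x :: "'a::unital_cstar_algebra"
  assumes x: "x \<in> G"
  shows "subgroup {y \<in> G. x * y * iv x * iv y \<in> root_group} GA"
proof (rule subgroup_GA_I)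
  show "1 \<in> {y \<in> G. x * y * iv x * iv y \<in> root_group}"
    using iv_right[OF x] by (simp add: G_one iv_one sub_one[OF root_group_subgroup])
  fix y assume "y \<in> {y \<in> G. x * y * iv x * iv y \<in> root_group}"
  then have y: "y \<in> G" "x * y * iv x * iv y \<in> root_group" by auto
  have "iv y * iv (x * y * iv x * iv y) * iv (iv y) \<in> root_group"
    by (intro root_group_conj sub_iv[OF root_group_subgroup] y iv_closed)
  moreover have "iv y * iv (x * y * iv x * iv y) * iv (iv y) = x * iv y * iv x * iv (iv y)"
    using x y(1) by (simp add: iv_mult G_mult iv_cancel mult.assoc)
  ultimately show "iv y \<in> {y \<in> G. x * y * iv x * iv y \<in> root_group}" using y(1) by simp
  fix z assume "z \<in> {y \<in> G. x * y * iv x * iv y \<in> root_group}"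
  then have z: "z \<in> G" "x * z * iv x * iv z \<in> root_group" by auto
  have "(x * y * iv x * iv y) * (y * (x * z * iv x * iv z) * iv y) \<in> root_group"
    by (intro root_group_conj sub_mult[OF root_group_subgroup] y z)
  moreover have "(x * y * iv x * iv y) * (y * (x * z * iv x * iv z) * iv y) = x * (y * z) * iv x * iv (y * z)"
    using x y(1) z(1) by (simp add: iv_mult G_mult iv_cancel mult.assoc)
  ultimately show "y * z \<in> {y \<in> G. x * y * iv x * iv y \<in> root_group}"
    using y(1) z(1) by (simp add: G_mult)
qed auto

definition central_mod_roots :: "'a::unital_cstar_algebra set" where
  "central_mod_roots = {x \<in> G. \<forall>y\<in>G. x * y * iv x * iv y \<in> root_group}"

lemma central_mod_roots_subgroup: "subgroup (central_mod_roots :: 'a::unital_cstar_algebra set) GA"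
proof (rule subgroup_GA_I)
  show "1 \<in> (central_mod_roots :: 'a set)"
    by (simp add: central_mod_roots_def G_one iv_right iv_one sub_one[OF root_group_subgroup])
  fix x :: 'a assume "x \<in> central_mod_roots"
  then have x: "x \<in> G" "\<And>y. y \<in> G \<Longrightarrow> x * y * iv x * iv y \<in> root_group"
    by (auto simp: central_mod_roots_def)
  have "iv x * y * iv (iv x) * iv y \<in> root_group" if y: "y \<in> G" for y
  proof -
    have "iv x * iv (x * y * iv x * iv y) * iv (iv x) \<in> root_group"
      by (intro root_group_conj sub_iv[OF root_group_subgroup] x y iv_closed)
    moreover have "iv x * iv (x * y * iv x * iv y) * iv (iv x) = iv x * y * iv (iv x) * iv y"
      using x(1) y by (simp add: iv_mult G_mult iv_cancel mult.assoc)
    ultimately show ?thesis by simp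
  qed
  then show "iv x \<in> central_mod_roots" using x(1) by (simp add: central_mod_roots_def)
  fix z :: 'a assume "z \<in> central_mod_roots"
  then have z: "z \<in> G" "\<And>y. y \<in> G \<Longrightarrow> z * y * iv z * iv y \<in> root_group"
    by (auto simp: central_mod_roots_def)
  have "x * z * y * iv (x * z) * iv y \<in> root_group" if y: "y \<in> G" for y
  proof -
    have "x * (z * y * iv z * iv y) * iv x * (x * y * iv x * iv y) \<in> root_group"
      by (intro root_group_conj sub_mult[OF root_group_subgroup] x z y)
    moreover have "x * (z * y * iv z * iv y) * iv x * (x * y * iv x * iv y) = x * z * y * iv (x * z) * iv y"
      using x(1) z(1) y by (simp add: iv_mult G_mult iv_cancel mult.assoc)
    ultimately show ?thesis by simp
  qed
  then show "x * z \<in> central_mod_roots" using x(1) z(1) by (simp add: central_mod_roots_def G_mult)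
qed (auto simp: central_mod_roots_def)

lemma central_mod_roots_conj:
  fixes x :: "'a::unital_cstar_algebra"
  assumes "x \<in> central_mod_roots" "g \<in> G" shows "g * x * iv g \<in> central_mod_roots"
proof -
  have x: "x \<in> G" "\<And>y. y \<in> G \<Longrightarrow> x * y * iv x * iv y \<in> root_group"
    using assms(1) by (auto simp: central_mod_roots_def)
  have "g * x * iv g * y * iv (g * x * iv g) * iv y \<in> root_group" if y: "y \<in> G" for y
  proof -
    have "g * (x * (iv g * y * g) * iv x * iv (iv g * y * g)) * iv g \<in> root_group"
      using assms(2) y by (intro root_group_conj x G_mult iv_closed)
    moreover have "g * (x * (iv g * y * g) * iv x * iv (iv g * y * g)) * iv g
        = g * x * iv g * y * iv (g * x * iv g) * iv y"
      using x(1) assms(2) y by (simp add: iv_mult G_mult iv_cancel mult.assoc)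
    ultimately show ?thesis by simp
  qed
  then show ?thesis using x(1) assms(2) by (simp add: central_mod_roots_def G_mult)
qed

context simple_cstar
begin

text \<open>
  The elements \<open>y\<close> that commute with \<open>x = 1 + c b\<close> modulo root elements form a subgroup \<open>\<Gamma>\<close>. It
  contains the root group. It contains \<open>y = 1 + b' d\<close> for small \<open>b'\<close>, because \<open>d c = 0\<close> makes the
  commutator of \<open>x\<close> and \<open>y\<close> a single root element \<open>1 + c q d\<close>. Conjugates by root elements
  \<open>e\<close> give \<open>1 + b' d e\<close>. Hence the left ideal of \<open>near_left_add\<close> is full, which makes
  \<open>\<Gamma>\<close> a neighbourhood of \<open>1\<close> and hence all of \<open>G\<close>.
\<close>

lemma near_one_central_mod_roots:
  fixes c d b :: 'a
  assumes cd: "null_pair c d" and b: "norm (c * b) < 1"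
  shows "1 + c * b \<in> central_mod_roots"
proof -
  have dc: "d * c = 0" using cd by (simp add: null_pair_def)
  define x where "x = 1 + c * b"
  have xG: "x \<in> G" unfolding x_def by (rule near_one_in_G[OF b])
  define \<Gamma> where "\<Gamma> = {y \<in> G. x * y * iv x * iv y \<in> root_group}"
  have \<Gamma>: "subgroup \<Gamma> GA" unfolding \<Gamma>_def by (rule root_group_commutator_right[OF xG])
  have root\<Gamma>: "y \<in> \<Gamma>" if y: "y \<in> root_group" for y
  proof -
    have "x * y * iv x * iv y \<in> root_group"
      by (intro sub_mult[OF root_group_subgroup] root_group_conj sub_iv[OF root_group_subgroup] y xG)
    then show ?thesis using sub_G[OF root_group_subgroup y] by (simp add: \<Gamma>_def)
  qed
  have left: "1 + b' * d \<in> \<Gamma>" if b': "norm (b' * d) < 1" for b'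
  proof -
    define y where "y = 1 + b' * d"
    have yG: "y \<in> G" unfolding y_def by (rule near_one_in_G[OF b'])
    have "d * x = d" by (simp add: x_def distrib_left dc flip: mult.assoc)
    then have dx: "d * iv x = d" using iv_right[OF xG] by (metis mult.assoc mult_1_right)
    have "iv y = 1 - iv y * b' * d" using iv_left[OF yG] by (simp add: y_def algebra_simps)
    from arg_cong[OF this, of "\<lambda>z. d * z"] have "d * iv y = (1 - d * iv y * b') * d"
      by (simp add: algebra_simps)
    then obtain q where dy: "d * iv y = q * d" by blast
    have "x * y = y * x + c * b * b' * d"
    proof -
      have "b' * d * (c * b) = 0" by (metis dc mult.assoc mult_zero_left mult_zero_right)
      then show ?thesis by (simp add: x_def y_def algebra_simps)
    qed
    then have "x * y * iv x * iv y = y * (x * iv x) * iv y + c * b * b' * (d * iv x) * iv y"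
      by (simp add: distrib_right mult.assoc)
    also have "\<dots> = 1 + c * b * b' * (d * iv y)"
      using iv_right[OF xG] iv_right[OF yG] dx by (simp add: mult.assoc)
    also have "\<dots> = 1 + c * (b * b' * q) * d"
      unfolding dy by (simp only: mult.assoc)
    finally have "x * y * iv x * iv y \<in> root_group" using root_in_root_group[OF cd] by simp
    then show ?thesis using yG by (simp add: \<Gamma>_def y_def)
  qed
  define L where "L = {z. \<exists>\<delta>>0. \<forall>b. norm b < \<delta> \<longrightarrow> 1 + b * z \<in> \<Gamma>}"
  have add: "y + z \<in> L" if "y \<in> L" "z \<in> L" for y z
    using near_left_add[OF \<Gamma>] that unfolding L_def by blast
  have mult: "a * z \<in> L" if "z \<in> L" for a z
    using near_left_mult that unfolding L_def by blast
  have pos: "norm d + 1 > 0" using norm_ge_zero[of d] by linarith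
  have dL: "d \<in> L"
  proof -
    have "1 + b' * d \<in> \<Gamma>" if "norm b' < 1 / (norm d + 1)" for b'
    proof (rule left)
      have "norm (b' * d) \<le> norm b' * (norm d + 1)"
        by (rule order_trans[OF norm_mult_ineq]) (simp add: mult_left_mono)
      also have "\<dots> < 1" using that pos by (simp add: field_simps)
      finally show "norm (b' * d) < 1" .
    qed
    then show ?thesis using pos unfolding L_def by (intro CollectI exI[of _ "1 / (norm d + 1)"]) simp
  qed
  have "d * (c' * a * d') \<in> L" if cd': "null_pair c' d'" for c' a d'
  proof -
    define e where "e = 1 + c' * a * d'"
    have e: "e \<in> \<Gamma>" unfolding e_def by (intro root\<Gamma> root_in_root_group[OF cd'])
    have eG: "e \<in> G" by (rule sub_G[OF \<Gamma> e])
    obtain \<delta> where \<delta>: "\<delta> > 0" "\<And>b. norm b < \<delta> \<Longrightarrow> 1 + b * d \<in> \<Gamma>"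
      using dL unfolding L_def by blast
    have pos: "norm e + 1 > 0" using norm_ge_zero[of e] by linarith
    have "1 + b * (d * e) \<in> \<Gamma>" if "norm b < \<delta> / (norm e + 1)" for b
    proof -
      have "norm (e * b) \<le> (norm e + 1) * norm b"
        by (rule order_trans[OF norm_mult_ineq]) (simp add: mult_right_mono)
      also have "\<dots> < \<delta>" using that pos by (simp add: field_simps)
      finally have "iv e * (1 + e * b * d) * e \<in> \<Gamma>"
        by (intro sub_mult[OF \<Gamma>] sub_iv[OF \<Gamma>] \<delta> e)
      then show ?thesis by (simp add: distrib_left distrib_right mult.assoc iv_cancel[OF eG])
    qed
    then have "d * e \<in> L" using \<delta>(1) pos unfolding L_def
      by (intro CollectI exI[of _ "\<delta> / (norm e + 1)"]) simp
    from add[OF this mult[OF dL, of "- 1"]] show ?thesis by (simp add: e_def distrib_left)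
  qed
  from left_ideal_full[OF cd add mult dL this] have "1 \<in> L" .
  then obtain \<delta> where "\<delta> > 0" "\<And>b. norm b < \<delta> \<Longrightarrow> 1 + b \<in> \<Gamma>" unfolding L_def by auto
  then have "\<Gamma> = G" by (rule open_subgroup_eq_G[OF \<Gamma>])
  then show ?thesis using xG unfolding \<Gamma>_def central_mod_roots_def x_def by blast
qed


text \<open>
  For small \<open>b\<close> the elements \<open>1 + c b\<close> and their conjugates \<open>1 + g c b g\<^sup>-\<^sup>1\<close> are central modulo root
  elements. Now the right ideal of all \<open>z\<close> for which \<open>1 + z b\<close> is central for small \<open>b\<close> contains
  every \<open>g c\<close>, so it is full, and the quotient of \<open>G\<close> by the root group is abelian.
\<close>

proposition commutators_in_root_group:
  assumes cd: "null_pair c (d::'a)"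
  shows "K \<subseteq> (root_group :: 'a set)"
proof -
  let ?Z = "central_mod_roots :: 'a set"
  note Z = central_mod_roots_subgroup
  define R where "R = {z :: 'a. \<exists>\<delta>>0. \<forall>b. norm b < \<delta> \<longrightarrow> 1 + z * b \<in> ?Z}"
  have add: "y + z \<in> R" if "y \<in> R" "z \<in> R" for y z
    using near_right_add[OF Z] that unfolding R_def by blast
  have mult: "z * a \<in> R" if "z \<in> R" for a z
    using near_right_mult that unfolding R_def by blast
  have c0: "c \<noteq> 0" using cd by (simp add: null_pair_def)
  have pos: "norm c + 1 > 0" using norm_ge_zero[of c] by linarith
  have cR: "c \<in> R"
  proof -
    have "1 + c * b \<in> ?Z" if "norm b < 1 / (norm c + 1)" for b
    proof (rule near_one_central_mod_roots[OF cd])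
      have "norm (c * b) \<le> (norm c + 1) * norm b"
        by (rule order_trans[OF norm_mult_ineq]) (simp add: mult_right_mono)
      also have "\<dots> < 1" using that pos by (simp add: field_simps)
      finally show "norm (c * b) < 1" .
    qed
    then show ?thesis using pos unfolding R_def by (intro CollectI exI[of _ "1 / (norm c + 1)"]) simp
  qed
  have gR: "g * c \<in> R" if g: "g \<in> G" for g
  proof -
    obtain \<delta> where \<delta>: "\<delta> > 0" "\<And>b. norm b < \<delta> \<Longrightarrow> 1 + c * b \<in> ?Z"
      using cR unfolding R_def by blast
    have pos: "norm g + 1 > 0" using norm_ge_zero[of g] by linarith
    have "1 + g * c * b \<in> ?Z" if "norm b < \<delta> / (norm g + 1)" for b
    proof -
      have "norm (b * g) \<le> norm b * (norm g + 1)"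
        by (rule order_trans[OF norm_mult_ineq]) (simp add: mult_left_mono)
      also have "\<dots> < \<delta>" using that pos by (simp add: field_simps)
      finally have "g * (1 + c * (b * g)) * iv g \<in> ?Z"
        by (intro central_mod_roots_conj \<delta> g)
      then show ?thesis using iv_cancel[OF g] by (simp add: distrib_left distrib_right mult.assoc)
    qed
    then show ?thesis using \<delta>(1) pos unfolding R_def
      by (intro CollectI exI[of _ "\<delta> / (norm g + 1)"]) simp
  qed
  have "a * c * b \<in> R" for a b
  proof -
    obtain t where t: "t > 0" "norm (t *\<^sub>R a) < 1" using small_scale[of 1] by auto
    have "(1 + t *\<^sub>R a) * c + c * (- 1) \<in> R"
      by (intro add gR near_one_in_G mult cR t)
    from mult[OF this, of "(1 / t) *\<^sub>R b"] show ?thesis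
      using t(1) by (simp add: distrib_right)
  qed
  from full_induct[OF c0, where P = "\<lambda>x. x \<in> R", OF this add] have "1 \<in> R" .
  then obtain \<delta> where "\<delta> > 0" "\<And>b. norm b < \<delta> \<Longrightarrow> 1 + b \<in> ?Z" unfolding R_def by auto
  then have "?Z = G" by (rule open_subgroup_eq_G[OF Z])
  then show ?thesis
    by (intro K_least[OF root_group_subgroup]) (auto simp: central_mod_roots_def)
qed

proposition noncentral_contains_commutators:
  fixes H :: "'a set"
  assumes H: "commutator_normalized H" and nc: "\<not> H \<subseteq> algebra_center"
  shows "K \<subseteq> H"
proof -
  obtain h where h: "h \<in> H" "h \<notin> algebra_center" using nc by blast
  then obtain a where "h * a \<noteq> a * h" unfolding algebra_center_def by blast
  then obtain c d :: 'a where cd: "null_pair c d"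
    using noncommutative_imp_zero_divisors unfolding null_pair_def by metis
  have "root_group \<subseteq> H"
    unfolding root_group_def
    using H noncentral_contains_roots[OF H h]
    by (intro GA.generate_subgroup_incl) (auto simp: commutator_normalized_def)
  then show ?thesis using commutators_in_root_group[OF cd] by blast
qed

end

lemma normalized_by_imp_commutator_normalized:
  fixes H :: "'a::unital_cstar_algebra set"
  assumes "subgroup H GA" "normalized_by GA H K"
  shows "commutator_normalized H"
  unfolding commutator_normalized_def
proof (intro conjI ballI assms(1))
  fix k h :: 'a assume "k \<in> K" "h \<in> H"
  then have "k * h * iv k \<in> (\<lambda>h. k \<otimes>\<^bsub>GA\<^esub> h \<otimes>\<^bsub>GA\<^esub> iv k) ` H" by simp
  also have "\<dots> = H" using assms(2) \<open>k \<in> K\<close> unfolding normalized_by_def by blast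
  finally show "k * h * iv k \<in> H" .
qed

lemma comm_GA_mult [simp]: "x \<otimes>\<^bsub>comm_GA\<^esub> y = x * y"
  by (simp add: comm_GA_def)

lemma group_comm_GA: "group (comm_GA :: 'a::unital_cstar_algebra monoid)"
  using subgroup.subgroup_is_group[OF K_subgroup group_GA] by (simp add: comm_GA_def)

lemma comm_GA_inv:
  assumes "x \<in> K" shows "m_inv comm_GA x = iv x"
  using GA.m_inv_consistent[OF K_subgroup assms] by (simp add: comm_GA_def)

lemma group_center_normal:
  assumes "group M" shows "group_center M \<lhd> M"
proof -
  interpret M: group M by (rule assms)
  show ?thesis
  proof (rule M.normal_invI)
    show "subgroup (group_center M) M"
    proof (rule M.subgroupI)
      show "group_center M \<noteq> {}" unfolding group_center_def by (auto intro!: exI[of _ "\<one>\<^bsub>M\<^esub>"])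
      show "inv\<^bsub>M\<^esub> z \<in> group_center M" if "z \<in> group_center M" for z
      proof -
        have z: "z \<in> carrier M" "\<And>x. x \<in> carrier M \<Longrightarrow> z \<otimes>\<^bsub>M\<^esub> x = x \<otimes>\<^bsub>M\<^esub> z"
          using that by (auto simp: group_center_def)
        have "inv\<^bsub>M\<^esub> z \<otimes>\<^bsub>M\<^esub> x = x \<otimes>\<^bsub>M\<^esub> inv\<^bsub>M\<^esub> z" if x: "x \<in> carrier M" for x
        proof -
          have "z \<otimes>\<^bsub>M\<^esub> (x \<otimes>\<^bsub>M\<^esub> inv\<^bsub>M\<^esub> z) = x"
            using z x by (simp flip: M.m_assoc) (simp add: M.m_assoc)
          then show ?thesis using z(1) x by (metis M.inv_closed M.inv_solve_left M.m_closed)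
        qed
        then show ?thesis using z(1) by (simp add: group_center_def)
      qed
      show "z \<otimes>\<^bsub>M\<^esub> z' \<in> group_center M" if "z \<in> group_center M" "z' \<in> group_center M" for z z'
      proof -
        have z: "z \<in> carrier M" "\<And>x. x \<in> carrier M \<Longrightarrow> z \<otimes>\<^bsub>M\<^esub> x = x \<otimes>\<^bsub>M\<^esub> z"
          and z': "z' \<in> carrier M" "\<And>x. x \<in> carrier M \<Longrightarrow> z' \<otimes>\<^bsub>M\<^esub> x = x \<otimes>\<^bsub>M\<^esub> z'"
          using that by (auto simp: group_center_def)
        have "z \<otimes>\<^bsub>M\<^esub> z' \<otimes>\<^bsub>M\<^esub> x = x \<otimes>\<^bsub>M\<^esub> (z \<otimes>\<^bsub>M\<^esub> z')" if x: "x \<in> carrier M" for x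
          using z(1) z'(1) x z(2)[OF x] z'(2)[OF x] by (metis M.m_assoc)
        then show ?thesis using z(1) z'(1) by (simp add: group_center_def)
      qed
    qed (auto simp: group_center_def)
    show "x \<otimes>\<^bsub>M\<^esub> h \<otimes>\<^bsub>M\<^esub> inv\<^bsub>M\<^esub> x \<in> group_center M" if "h \<in> group_center M" "x \<in> carrier M" for x h
    proof -
      have "x \<otimes>\<^bsub>M\<^esub> h \<otimes>\<^bsub>M\<^esub> inv\<^bsub>M\<^esub> x = h"
      proof -
        have h: "h \<in> carrier M" "x \<otimes>\<^bsub>M\<^esub> h = h \<otimes>\<^bsub>M\<^esub> x"
          using that by (auto simp: group_center_def)
        show ?thesis unfolding h(2) using h(1) that(2) by (simp add: M.m_assoc)
      qed
      then show ?thesis using that by simp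
    qed
  qed
qed

text \<open>
  Normal subgroups of the quotient correspond to their preimages.
\<close>

lemma simple_modulo_centerI:
  assumes M: "group M"
    and dich: "\<And>N. N \<lhd> M \<Longrightarrow> N \<subseteq> group_center M \<or> N = carrier M"
  shows "simple_modulo_center M"
proof -
  let ?C = "group_center M"
  interpret C: normal ?C M by (rule group_center_normal[OF M])
  show ?thesis
    unfolding simple_modulo_center_def
  proof (intro conjI M allI impI)
    fix N assume N: "N \<lhd> (M Mod ?C)"
    interpret N: normal N "M Mod ?C" by (rule N)
    interpret hom: group_hom M "M Mod ?C" "\<lambda>x. ?C #>\<^bsub>M\<^esub> x"
      by (intro group_hom.intro group_hom_axioms.intro C.r_coset_hom_Mod M C.factorgroup_is_group)
    define H where "H = {x \<in> carrier M. ?C #>\<^bsub>M\<^esub> x \<in> N}"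
    have "H \<lhd> M"
    proof (rule C.normal_invI)
      show "subgroup H M"
        using subgroup.one_closed[OF N.subgroup_axioms] subgroup.m_closed[OF N.subgroup_axioms]
        by (intro C.subgroupI) (auto simp: H_def intro!: exI[of _ "\<one>\<^bsub>M\<^esub>"])
      show "x \<otimes>\<^bsub>M\<^esub> h \<otimes>\<^bsub>M\<^esub> inv\<^bsub>M\<^esub> x \<in> H" if "h \<in> H" "x \<in> carrier M" for x h
        using that N.inv_op_closed2[of "?C #>\<^bsub>M\<^esub> x" "?C #>\<^bsub>M\<^esub> h"] by (auto simp: H_def)
    qed
    from dich[OF this] show "N = {\<one>\<^bsub>M Mod ?C\<^esub>} \<or> N = carrier (M Mod ?C)"
    proof
      assume sub: "H \<subseteq> ?C"
      have "X = \<one>\<^bsub>M Mod ?C\<^esub>" if X: "X \<in> N" for X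
      proof -
        have "X \<in> carrier (M Mod ?C)" using X N.subset by blast
        then obtain x where x: "x \<in> carrier M" "X = ?C #>\<^bsub>M\<^esub> x"
          by (auto simp: FactGroup_def RCOSETS_def)
        then have "x \<in> ?C" using sub X by (auto simp: H_def)
        then show ?thesis using x C.rcos_const by (simp add: FactGroup_def)
      qed
      then show ?thesis using subgroup.one_closed[OF N.subgroup_axioms] by blast
    next
      assume "H = carrier M"
      then have "carrier (M Mod ?C) \<subseteq> N"
        by (auto simp: FactGroup_def RCOSETS_def H_def)
      then show ?thesis using N.subset by blast
    qed
  qed
qed

theorem corollary5p7:
  assumes "simple_cstar_algebra TYPE('a::unital_cstar_algebra)"
  shows "(\<forall>H :: 'a set.
            subgroup H GA \<and> normalized_by GA H (carrier comm_GA) \<longrightarrow>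
              H \<subseteq> algebra_center \<or> carrier comm_GA \<subseteq> H) \<and>
         simple_modulo_center (comm_GA :: 'a monoid)"
proof (intro conjI allI impI)
  interpret simple_cstar "TYPE('a)" by unfold_locales (rule assms)
  fix H :: "'a set"
  assume "subgroup H GA \<and> normalized_by GA H K"
  then show "H \<subseteq> algebra_center \<or> K \<subseteq> H"
    using noncentral_contains_commutators normalized_by_imp_commutator_normalized by blast
next
  interpret simple_cstar "TYPE('a)" by unfold_locales (rule assms)
  show "simple_modulo_center (comm_GA :: 'a monoid)"
  proof (rule simple_modulo_centerI[OF group_comm_GA])
    fix N :: "'a set" assume N: "N \<lhd> comm_GA"
    have sub: "subgroup N comm_GA" by (rule normal_imp_subgroup[OF N])
    then have NK: "N \<subseteq> K" by (rule subgroup.subset)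
    have "subgroup N GA"
      using GA.incl_subgroup[OF K_subgroup] sub by (simp add: comm_GA_def)
    moreover have "k * h * iv k \<in> N" if "k \<in> K" "h \<in> N" for k h
      using normal.inv_op_closed2[OF N that] comm_GA_inv[OF that(1)] by simp
    ultimately have "commutator_normalized N" unfolding commutator_normalized_def by blast
    then have "N \<subseteq> algebra_center \<or> K \<subseteq> N" using noncentral_contains_commutators by blast
    then show "N \<subseteq> group_center comm_GA \<or> N = K"
      using NK by (auto simp: group_center_def algebra_center_def)
  qed
qed

end
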